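(* Let $g$ be the Kerr-Newman-(anti-)de Sitter metric with real parameters $a,m,q,\Lambda$ (see context) and write $c=\cos\theta$. Then the Karlhede invariant $\mathfrak{K}=\nabla_\mu R_{\alpha\beta\gamma\delta}\nabla^\mu R^{\alpha\beta\gamma\delta}$ of $g$ equals $$\begin{aligned} \mathfrak K=\frac{1}{3(r^2+a^2c^2)^9}\Big[&720\Lambda a^{12}m^2c^{12}-720a^{10}\Big(\Lambda a^2m^2+28\Lambda m^2r^2-16\Lambda mq^2r+\tfrac{76}{45}\Lambda q^4-3m^2\Big)c^{10}\\ &+19440\,a^8\Big(\tfrac{23\Lambda m^2r^4}{9}-\tfrac{8\Lambda mq^2r^3}{3}+\big(\Lambda a^2m^2+\tfrac{248}{405}\Lambda q^4-3m^2\big)r^2-\tfrac{16m(a^2q^2\Lambda+\frac38m^2-3q^2)r}{27}\\ &\qquad+\tfrac{76q^2(a^2q^2\Lambda+\frac{135}{76}m^2-3q^2)}{1215}\Big)c^8\\ &-30240\,a^6\Big(-\tfrac{22\Lambda mq^2r^5}{35}+\big(\Lambda a^2m^2+\tfrac{278}{945}\Lambda q^4-3m^2\big)r^4-\tfrac{10m(a^2q^2\Lambda+\frac{14}{5}m^2-3q^2)r^3}{7}\\ &\qquad+\tfrac{356q^2(a^2q^2\Lambda+\frac{1755}{178}m^2-3q^2)r^2}{945}+\tfrac{2q^2(a^2-\frac{151q^2}{45})mr}{7}-\tfrac{22a^2q^4}{315}+\tfrac{16q^6}{315}\Big)c^6\\ &-30240\,a^4r^2\Big(\tfrac{23\Lambda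 m^2r^6}{14}-\tfrac{166\Lambda mq^2r^5}{105}+\big(\Lambda a^2m^2+\tfrac{278}{945}\Lambda q^4-3m^2\big)r^4-\tfrac{74(a^2q^2\Lambda-\frac{525}{37}m^2-3q^2)mr^3}{105}\\ &\qquad-\tfrac{103m^2q^2r^2}{7}-\tfrac{2q^2(a^2-\frac{353q^2}{15})mr}{7}+\tfrac{26a^2q^4}{105}-\tfrac{14q^6}{15}\Big)c^4\\ &+19440\,a^2r^4\Big(\tfrac{28\Lambda m^2r^6}{27}-\tfrac{76\Lambda mq^2r^5}{45}+\big(\Lambda a^2m^2+\tfrac{248}{405}\Lambda q^4-3m^2\big)r^4-\tfrac{44(a^2q^2\Lambda-\frac{42}{11}m^2-3q^2)mr^3}{27}\\ &\qquad+\tfrac{712q^2(a^2q^2\Lambda-\frac{4023}{178}m^2-3q^2)r^2}{1215}+\tfrac{4q^2(a^2+\frac{295q^2}{27})mr}{5}-\tfrac{52a^2q^4}{135}-\tfrac{248q^6}{135}\Big)c^2\\ &-720\,r^6\Big(\Lambda m^2r^6-\tfrac{12\Lambda mq^2r^5}{5}+\big(\Lambda a^2m^2+\tfrac{76}{45}\Lambda q^4-3m^2\big)r^4-\tfrac{12(a^2q^2\Lambda-\frac52m^2-3q^2)mr^3}{5}\\ &\qquad+\tfrac{76q^2(a^2q^2\Lambda-\frac{783}{76}m^2-3q^2)r^2}{45}+\tfrac{12q^2(a^2+\frac{65q^2}{9})mr}{5}-\tfrac{44a^2q^4}{15}-\tfrac{76q^6}{15}\Big)\Big]. \end{aligned}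$$
   Context: Kerr-Newman-(anti-)de Sitter metric: in coordinates $(t,r,\theta,\phi)$, with signature $(-,+,+,+)$, $$ds^2=-\frac{\Delta_r}{\Xi^2\rho^2}(dt-a\sin^2\theta\,d\phi)^2+\frac{\rho^2}{\Delta_r}dr^2+\frac{\rho^2}{\Delta_\theta}d\theta^2+\frac{\Delta_\theta\sin^2\theta}{\Xi^2\rho^2}\big(a\,dt-(r^2+a^2)d\phi\big)^2,$$ $\Delta_\theta=1+\frac{a^2\Lambda}{3}\cos^2\theta$, $\Xi=1+\frac{a^2\Lambda}{3}$, $\Delta_r=(1-\frac{\Lambda}{3}r^2)(r^2+a^2)-2mr+q^2$, $\rho^2=r^2+a^2\cos^2\theta$. Here $a,m,q,\Lambda$ are the Kerr (rotation) parameter, mass, electric charge and cosmological constant. The identity is on the domain where the metric is regular ($\rho^2\ne0$, $\Delta_r\neq0$, $\Delta_\theta>0$, $\Xi\ne0$, $\sin\theta\neq0$). $R_{\alpha\beta\gamma\delta}$ is the Riemann tensor and $\nabla$ the Levi-Civita connection of $g$. *)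

theory Defs
  imports "HOL-Analysis.Analysis"
begin

section \<open>Tensor calculus of a metric in a coordinate chart\<close>

text \<open>
  A metric on (part of) a chart is a matrix field; other tensor fields are families of component
  functions, the index arguments preceding the point.
\<close>

type_synonym 'n metric = "real ^ 'n \<Rightarrow> real ^ 'n ^ 'n"

definition partial :: "'n::finite \<Rightarrow> (real ^ 'n \<Rightarrow> real) \<Rightarrow> real ^ 'n \<Rightarrow> real" where
  "partial i f x = deriv (\<lambda>h. f (x + h *\<^sub>R axis i 1)) 0"

definition inv_metric :: "'n::finite metric \<Rightarrow> 'n \<Rightarrow> 'n \<Rightarrow> real ^ 'n \<Rightarrow> real" where
  "inv_metric g i j x = matrix_inv (g x) $ i $ j"

text \<open>
  The symbols \<open>\<Gamma>\<^sup>i\<^bsub>jk\<^esub>\<close> of the Levi-Civita connection.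
\<close>

definition christoffel :: "'n::finite metric \<Rightarrow> 'n \<Rightarrow> 'n \<Rightarrow> 'n \<Rightarrow> real ^ 'n \<Rightarrow> real" where
  "christoffel g i j k x =
     1 / 2 * (\<Sum>l\<in>UNIV. inv_metric g i l x *
       (partial j (\<lambda>y. g y $ l $ k) x + partial k (\<lambda>y. g y $ l $ j) x
        - partial l (\<lambda>y. g y $ j $ k) x))"

text \<open>
  \<open>R\<^sup>i\<^bsub>jkl\<^esub>\<close>, with \<open>(\<nabla>\<^sub>k \<nabla>\<^sub>l - \<nabla>\<^sub>l \<nabla>\<^sub>k) V\<^sup>i = R\<^sup>i\<^bsub>jkl\<^esub> V\<^sup>j\<close>. The opposite sign convention
  gives the same Karlhede invariant, which is quadratic in the curvature.
\<close>

definition riemann_up :: "'n::finite metric \<Rightarrow> 'n \<Rightarrow> 'n \<Rightarrow> 'n \<Rightarrow> 'n \<Rightarrow> real ^ 'n \<Rightarrow> real" where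
  "riemann_up g i j k l x =
     partial k (christoffel g i l j) x - partial l (christoffel g i k j) x
     + (\<Sum>e\<in>UNIV. christoffel g i k e x * christoffel g e l j x)
     - (\<Sum>e\<in>UNIV. christoffel g i l e x * christoffel g e k j x)"

definition riemann :: "'n::finite metric \<Rightarrow> 'n \<Rightarrow> 'n \<Rightarrow> 'n \<Rightarrow> 'n \<Rightarrow> real ^ 'n \<Rightarrow> real" where
  "riemann g i j k l x = (\<Sum>e\<in>UNIV. g x $ i $ e * riemann_up g e j k l x)"

definition cov_deriv4 ::
  "'n::finite metric \<Rightarrow> ('n \<Rightarrow> 'n \<Rightarrow> 'n \<Rightarrow> 'n \<Rightarrow> real ^ 'n \<Rightarrow> real)
     \<Rightarrow> 'n \<Rightarrow> 'n \<Rightarrow> 'n \<Rightarrow> 'n \<Rightarrow> 'n \<Rightarrow> real ^ 'n \<Rightarrow> real" where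
  "cov_deriv4 g T \<mu> \<alpha> \<beta> \<gamma> \<delta> x =
     partial \<mu> (T \<alpha> \<beta> \<gamma> \<delta>) x
     - (\<Sum>e\<in>UNIV. christoffel g e \<mu> \<alpha> x * T e \<beta> \<gamma> \<delta> x)
     - (\<Sum>e\<in>UNIV. christoffel g e \<mu> \<beta> x * T \<alpha> e \<gamma> \<delta> x)
     - (\<Sum>e\<in>UNIV. christoffel g e \<mu> \<gamma> x * T \<alpha> \<beta> e \<delta> x)
     - (\<Sum>e\<in>UNIV. christoffel g e \<mu> \<delta> x * T \<alpha> \<beta> \<gamma> e x)"

definition raise5 ::
  "'n::finite metric \<Rightarrow> ('n \<Rightarrow> 'n \<Rightarrow> 'n \<Rightarrow> 'n \<Rightarrow> 'n \<Rightarrow> real ^ 'n \<Rightarrow> real)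
     \<Rightarrow> 'n \<Rightarrow> 'n \<Rightarrow> 'n \<Rightarrow> 'n \<Rightarrow> 'n \<Rightarrow> real ^ 'n \<Rightarrow> real" where
  "raise5 g T \<mu> \<alpha> \<beta> \<gamma> \<delta> x =
     (\<Sum>\<mu>'\<in>UNIV. \<Sum>\<alpha>'\<in>UNIV. \<Sum>\<beta>'\<in>UNIV. \<Sum>\<gamma>'\<in>UNIV. \<Sum>\<delta>'\<in>UNIV.
        inv_metric g \<mu> \<mu>' x * inv_metric g \<alpha> \<alpha>' x * inv_metric g \<beta> \<beta>' x *
        inv_metric g \<gamma> \<gamma>' x * inv_metric g \<delta> \<delta>' x * T \<mu>' \<alpha>' \<beta>' \<gamma>' \<delta>' x)"

definition karlhede :: "'n::finite metric \<Rightarrow> real ^ 'n \<Rightarrow> real" where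
  "karlhede g x =
     (\<Sum>\<mu>\<in>UNIV. \<Sum>\<alpha>\<in>UNIV. \<Sum>\<beta>\<in>UNIV. \<Sum>\<gamma>\<in>UNIV. \<Sum>\<delta>\<in>UNIV.
        cov_deriv4 g (riemann g) \<mu> \<alpha> \<beta> \<gamma> \<delta> x *
        raise5 g (cov_deriv4 g (riemann g)) \<mu> \<alpha> \<beta> \<gamma> \<delta> x)"

text \<open>
  The connection is torsion-free and compatible with the metric, i.e. it is the Levi-Civita
  connection wherever \<open>g\<close> is nondegenerate.
\<close>

lemma christoffel_torsion_free:
  assumes "\<And>y. transpose (g y) = g y"
  shows "christoffel g i j k x = christoffel g i k j x"
proof -
  have "g y $ j $ k = g y $ k $ j" for y
    by (metis assms transpose_def vec_lambda_beta)
  then show ?thesis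
    by (simp add: christoffel_def add.commute)
qed

lemma christoffel_metric_compatible:
  fixes g :: "'n::finite metric"
  assumes sym: "\<And>y. transpose (g y) = g y" and inv: "invertible (g x)"
  shows "partial k (\<lambda>y. g y $ i $ j) x
         - (\<Sum>e\<in>UNIV. christoffel g e k i x * g x $ e $ j)
         - (\<Sum>e\<in>UNIV. christoffel g e k j x * g x $ i $ e) = 0"
proof -
  have s: "g y $ p $ q = g y $ q $ p" for y p q
    by (metis sym transpose_def vec_lambda_beta)
  have "g x ** matrix_inv (g x) = mat 1"
    using inv unfolding invertible_def matrix_inv_def by (rule someI2_ex) simp
  then have d: "(\<Sum>e\<in>UNIV. g x $ j $ e * inv_metric g e l x) = (if j = l then 1 else 0)" for j l
    by (auto simp: matrix_matrix_mult_def mat_def vec_eq_iff inv_metric_def)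
  have low: "(\<Sum>e\<in>UNIV. g x $ j $ e * christoffel g e p q x) =
      1 / 2 * (partial p (\<lambda>y. g y $ j $ q) x + partial q (\<lambda>y. g y $ j $ p) x
        - partial j (\<lambda>y. g y $ p $ q) x)" for j p q
  proof -
    define K where "K l = partial p (\<lambda>y. g y $ l $ q) x + partial q (\<lambda>y. g y $ l $ p) x
        - partial l (\<lambda>y. g y $ p $ q) x" for l
    have "(\<Sum>e\<in>UNIV. g x $ j $ e * christoffel g e p q x) =
        (\<Sum>e\<in>UNIV. \<Sum>l\<in>UNIV. 1 / 2 * (g x $ j $ e * inv_metric g e l x * K l))"
      by (simp add: christoffel_def K_def sum_distrib_left sum_distrib_right mult_ac)
    also have "\<dots> = (\<Sum>l\<in>UNIV. 1 / 2 * ((\<Sum>e\<in>UNIV. g x $ j $ e * inv_metric g e l x) * K l))"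
      by (subst sum.swap) (simp add: sum_distrib_left sum_distrib_right)
    also have "\<dots> = 1 / 2 * K j"
      unfolding d by (simp add: if_distrib[of "\<lambda>u. u * _"] if_distrib[of "\<lambda>u. _ * u"]
          if_distrib[of "\<lambda>u. u / _"] cong: if_cong)
    finally show ?thesis
      by (simp add: K_def)
  qed
  have "(\<Sum>e\<in>UNIV. christoffel g e k i x * g x $ e $ j)
        = (\<Sum>e\<in>UNIV. g x $ j $ e * christoffel g e k i x)"
    by (simp add: s[of x j] mult.commute)
  moreover have "(\<Sum>e\<in>UNIV. christoffel g e k j x * g x $ i $ e)
        = (\<Sum>e\<in>UNIV. g x $ i $ e * christoffel g e k j x)"
    by (simp add: mult.commute)
  ultimately show ?thesis
    unfolding low by (simp add: s[of _ k] s[of _ j i])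
qed


section \<open>The Kerr-Newman-(anti-)de Sitter metric\<close>

text \<open>
  The coordinates \<open>(t, r, \<theta>, \<phi>)\<close> of a point \<open>x\<close> are \<open>x $ 1\<close>, \<open>x $ 2\<close>, \<open>x $ 3\<close>, \<open>x $ 4\<close>; in the
  four-element index type \<open>4\<close> the last index \<open>4\<close> is the same as \<open>0\<close>.
\<close>

definition Delta_theta :: "real \<Rightarrow> real \<Rightarrow> real \<Rightarrow> real" where
  "Delta_theta a \<Lambda> \<theta> = 1 + a^2 * \<Lambda> / 3 * (cos \<theta>)^2"

definition Xi :: "real \<Rightarrow> real \<Rightarrow> real" where
  "Xi a \<Lambda> = 1 + a^2 * \<Lambda> / 3"

definition Delta_r :: "real \<Rightarrow> real \<Rightarrow> real \<Rightarrow> real \<Rightarrow> real \<Rightarrow> real" where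
  "Delta_r a m q \<Lambda> r = (1 - \<Lambda> / 3 * r^2) * (r^2 + a^2) - 2 * m * r + q^2"

definition rho_sq :: "real \<Rightarrow> real \<Rightarrow> real \<Rightarrow> real" where
  "rho_sq a r \<theta> = r^2 + a^2 * (cos \<theta>)^2"

abbreviation coord_form :: "4 \<Rightarrow> real ^ 4" where
  "coord_form i \<equiv> axis i 1"

definition KNdS_metric :: "real \<Rightarrow> real \<Rightarrow> real \<Rightarrow> real \<Rightarrow> 4 metric" where
  "KNdS_metric a m q \<Lambda> x =
     (let r = x $ 2; \<theta> = x $ 3;
          dt = coord_form 1; dr = coord_form 2; d\<theta> = coord_form 3; d\<phi> = coord_form 4;
          \<omega> = dt - (a * (sin \<theta>)^2) *\<^sub>R d\<phi>;
          \<eta> = a *\<^sub>R dt - (r^2 + a^2) *\<^sub>R d\<phi>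
      in \<chi> i j.
           - (Delta_r a m q \<Lambda> r / ((Xi a \<Lambda>)^2 * rho_sq a r \<theta>)) * (\<omega> $ i * \<omega> $ j)
           + rho_sq a r \<theta> / Delta_r a m q \<Lambda> r * (dr $ i * dr $ j)
           + rho_sq a r \<theta> / Delta_theta a \<Lambda> \<theta> * (d\<theta> $ i * d\<theta> $ j)
           + Delta_theta a \<Lambda> \<theta> * (sin \<theta>)^2 / ((Xi a \<Lambda>)^2 * rho_sq a r \<theta>) * (\<eta> $ i * \<eta> $ j))"

end

theory Submission
  imports Defs
begin

text \<open>
  With \<open>u = cos \<theta>\<close> and \<open>\<Xi>\<close>, \<open>\<rho>\<^sup>2\<close>, \<open>\<Delta>\<^sub>r\<close> as in the metric, put \<open>P = \<Delta>\<^sub>\<theta> sin\<^sup>2 \<theta>\<close>. The coframe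
  \<open>(dt - a sin\<^sup>2 \<theta> d\<phi>) / \<Xi>\<close>, \<open>\<rho>\<^sup>2 dr / \<Delta>\<^sub>r\<close>, \<open>\<rho>\<^sup>2 du / P\<close>, \<open>(a dt - (r\<^sup>2 + a\<^sup>2) d\<phi>) / \<Xi>\<close> is orthogonal, with squared
  lengths \<open>- \<Delta>\<^sub>r / \<rho>\<^sup>2\<close>, \<open>\<Delta>\<^sub>r / \<rho>\<^sup>2\<close>, \<open>P / \<rho>\<^sup>2\<close>, \<open>P / \<rho>\<^sup>2\<close>. Unlike an orthonormal one it is rational in \<open>r\<close>, \<open>u\<close> and
  \<open>sin \<theta>\<close> and does not depend on the sign of \<open>\<Delta>\<^sub>r\<close>. Its connection coefficients are determined by metricity and
  vanishing torsion, the curvature is of type D in it, and only 34 independent components of \<open>\<nabla>R\<close> are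
  nonzero. Their weighted squares add up to \<open>(\<Delta>\<^sub>r A + a\<^sup>2 P B) / \<rho>\<^bsup>18\<^esup>\<close> with polynomials \<open>A\<close>, \<open>B\<close> that do not
  contain \<open>\<Lambda>\<close>, and expanding \<open>\<Delta>\<^sub>r\<close> and \<open>P\<close> gives the formula.
\<close>

section \<open>Partial derivatives along the coordinate axes\<close>

text \<open>Expanding the definitions in coordinates is impractical: every derivative acts on the
  inverse of the full t-phi block and the denominators multiply. The structure equations move the
  invariant into an orthogonal frame once and for all; after that each claim is a ring identity in a
  few scalars. Avoiding square roots has a price: the squared lengths are not constant, so metricity
  contains their derivatives and the final sum of squares carries weights. The factor
  \<open>Xi\<close> is a constant rescaling of t and phi and cancels from all frame components.
  Derivatives stay polynomial because r / \<rho>^2 and a cos \<theta> / \<rho>^2 are the real and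
  imaginary parts of 1 / (r - i a cos \<theta>), whose derivatives are multiples of its own square.
  The constant \<Lambda> disappears from the covariant derivative because it enters the curvature
  only through a constant-curvature term, which is built from the metric and hence parallel. In the
  result it survives through \<Delta>_r and P alone, and therefore linearly.\<close>

definition has_partial :: "'n::finite \<Rightarrow> (real ^ 'n \<Rightarrow> real) \<Rightarrow> real \<Rightarrow> real ^ 'n \<Rightarrow> bool" where
  "has_partial k f D x \<longleftrightarrow> ((\<lambda>h. f (x + h *\<^sub>R axis k 1)) has_real_derivative D) (at 0)"

text \<open>\<open>partial\<close> rests on \<open>deriv\<close>, which is an arbitrary value where
  no derivative exists, so its sum and product rules are available only together with this
  predicate.\<close>

definition pdiff :: "'n::finite \<Rightarrow> (real ^ 'n \<Rightarrow> real) \<Rightarrow> real ^ 'n \<Rightarrow> bool" where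
  "pdiff k f x \<longleftrightarrow> (\<exists>D. has_partial k f D x)"

lemma has_partial_imp: "has_partial k f D x \<Longrightarrow> partial k f x = D"
  by (simp add: has_partial_def partial_def DERIV_imp_deriv)

lemma has_partial_pdiff: "has_partial k f D x \<Longrightarrow> pdiff k f x"
  by (auto simp: pdiff_def)

lemma pdiff_has_partial: "pdiff k f x \<Longrightarrow> has_partial k f (partial k f x) x"
  by (auto simp: pdiff_def dest: has_partial_imp)

lemma has_partial_const: "has_partial k (\<lambda>y. c) 0 x"
  by (simp add: has_partial_def)

lemma has_partial_add:
  "has_partial k f D x \<Longrightarrow> has_partial k f' D' x \<Longrightarrow> has_partial k (\<lambda>y. f y + f' y) (D + D') x"
  by (simp add: has_partial_def DERIV_add)

lemma has_partial_mult:
  "has_partial k f D x \<Longrightarrow> has_partial k f' D' x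
    \<Longrightarrow> has_partial k (\<lambda>y. f y * f' y) (D * f' x + D' * f x) x"
  unfolding has_partial_def by (drule (1) DERIV_mult) simp

lemma has_partial_sum:
  "(\<And>i. i \<in> I \<Longrightarrow> has_partial k (f i) (D i) x)
    \<Longrightarrow> has_partial k (\<lambda>y. \<Sum>i\<in>I. f i y) (\<Sum>i\<in>I. D i) x"
  unfolding has_partial_def by (rule DERIV_sum)

text \<open>The preimage of the open set under the coordinate line is a neighbourhood of 0, so an
  identity that holds merely on the chart may be differentiated at each of its points.\<close>

lemma has_partial_cong:
  assumes "open U" "x \<in> U" "\<And>y. y \<in> U \<Longrightarrow> f y = f' y"
  shows "has_partial k f D x \<longleftrightarrow> has_partial k f' D x"
proof -
  have "open ((\<lambda>h. x + h *\<^sub>R axis k 1) -` U)"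
    by (intro open_vimage assms continuous_intros)
  then have "eventually (\<lambda>h. x + h *\<^sub>R axis k 1 \<in> U) (nhds (0::real))"
    unfolding eventually_nhds using assms(2) by (intro exI[of _ "(\<lambda>h. x + h *\<^sub>R axis k 1) -` U"]) auto
  then have "eventually (\<lambda>h. f (x + h *\<^sub>R axis k 1) = f' (x + h *\<^sub>R axis k 1)) (nhds (0::real))"
    by eventually_elim (rule assms(3))
  then show ?thesis
    unfolding has_partial_def by (intro DERIV_cong_ev) auto
qed

lemma pdiff_cong:
  assumes "open U" "x \<in> U" "\<And>y. y \<in> U \<Longrightarrow> f y = f' y"
  shows "pdiff k f x \<longleftrightarrow> pdiff k f' x"
  using has_partial_cong[OF assms] by (simp add: pdiff_def)

text \<open>Differentiability is not assumed: \<open>deriv\<close> chooses among the admissible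
  derivative values, and since these are the same for both functions, even the choice
  agrees.\<close>

lemma partial_cong:
  assumes "open U" "x \<in> U" "\<And>y. y \<in> U \<Longrightarrow> f y = f' y"
  shows "partial k f x = partial k f' x"
proof -
  have "has_partial k f D x \<longleftrightarrow> has_partial k f' D x" for D
    by (rule has_partial_cong[OF assms])
  then show ?thesis
    unfolding partial_def deriv_def has_partial_def[symmetric] by simp
qed

lemma pdiff_const: "pdiff k (\<lambda>y. c) x"
  using has_partial_const has_partial_pdiff by blast

lemma pdiff_add: "pdiff k f x \<Longrightarrow> pdiff k f' x \<Longrightarrow> pdiff k (\<lambda>y. f y + f' y) x"
  unfolding pdiff_def using has_partial_add by blast

lemma pdiff_mult: "pdiff k f x \<Longrightarrow> pdiff k f' x \<Longrightarrow> pdiff k (\<lambda>y. f y * f' y) x"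
  unfolding pdiff_def using has_partial_mult by blast

lemma pdiff_sum: "(\<And>i. i \<in> I \<Longrightarrow> pdiff k (f i) x) \<Longrightarrow> pdiff k (\<lambda>y. \<Sum>i\<in>I. f i y) x"
  by (rule has_partial_pdiff, rule has_partial_sum[where D = "\<lambda>i. partial k (f i) x"])
    (simp add: pdiff_has_partial)

lemma partial_add:
  "pdiff k f x \<Longrightarrow> pdiff k f' x \<Longrightarrow> partial k (\<lambda>y. f y + f' y) x = partial k f x + partial k f' x"
  by (rule has_partial_imp, rule has_partial_add) (erule pdiff_has_partial)+

lemma partial_mult:
  "pdiff k f x \<Longrightarrow> pdiff k f' x
    \<Longrightarrow> partial k (\<lambda>y. f y * f' y) x = partial k f x * f' x + f x * partial k f' x"
  by (simp add: has_partial_imp[OF has_partial_mult[OF pdiff_has_partial pdiff_has_partial]])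

lemma partial_sum:
  "(\<And>i. i \<in> I \<Longrightarrow> pdiff k (f i) x)
    \<Longrightarrow> partial k (\<lambda>y. \<Sum>i\<in>I. f i y) x = (\<Sum>i\<in>I. partial k (f i) x)"
  by (rule has_partial_imp, rule has_partial_sum) (simp add: pdiff_has_partial)

lemmas pdiff_intros = pdiff_const pdiff_add pdiff_mult pdiff_sum

lemma pdiff_minus: "pdiff k f x \<Longrightarrow> pdiff k (\<lambda>y. - f y) x"
  using pdiff_mult[OF pdiff_const[of k "- 1"], of f] by simp

lemma pdiff_diff: "pdiff k f x \<Longrightarrow> pdiff k f' x \<Longrightarrow> pdiff k (\<lambda>y. f y - f' y) x"
  using pdiff_add[of k f x "\<lambda>y. - f' y", OF _ pdiff_minus] by simp

lemma pdiff_power: "pdiff k f x \<Longrightarrow> pdiff k (\<lambda>y. f y ^ n) x"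
  by (induction n) (simp_all add: pdiff_const pdiff_mult)

lemma pdiff_divide:
  assumes "pdiff k f x" "pdiff k f' x" "f' x \<noteq> 0"
  shows "pdiff k (\<lambda>y. f y / f' y) x"
proof -
  obtain D D' where "((\<lambda>h. f (x + h *\<^sub>R axis k 1)) has_real_derivative D) (at 0)"
    "((\<lambda>h. f' (x + h *\<^sub>R axis k 1)) has_real_derivative D') (at 0)"
    using assms(1,2) unfolding pdiff_def has_partial_def by blast
  then have "((\<lambda>h. f (x + h *\<^sub>R axis k 1) / f' (x + h *\<^sub>R axis k 1)) has_real_derivative
      (D * f' (x + 0 *\<^sub>R axis k 1) - f (x + 0 *\<^sub>R axis k 1) * D')
        / (f' (x + 0 *\<^sub>R axis k 1) * f' (x + 0 *\<^sub>R axis k 1))) (at 0)"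
    by (rule DERIV_divide) (simp add: assms(3))
  then show ?thesis
    unfolding pdiff_def has_partial_def by blast
qed

lemma pdiff_component: "pdiff k (\<lambda>y. y $ i) x"
proof -
  have "((\<lambda>h. x $ i + h * (axis k 1 $ i)) has_real_derivative axis k 1 $ i) (at 0)"
    by (rule derivative_eq_intros refl)+ simp
  then show ?thesis
    unfolding pdiff_def has_partial_def by auto
qed

lemma pdiff_chain:
  assumes "(F has_real_derivative D) (at (f x))" "pdiff k f x"
  shows "pdiff k (\<lambda>y. F (f y)) x"
proof -
  obtain D' where "((\<lambda>h. f (x + h *\<^sub>R axis k 1)) has_real_derivative D') (at 0)"
    using assms(2) unfolding pdiff_def has_partial_def by blast
  then have "((\<lambda>h. F (f (x + h *\<^sub>R axis k 1))) has_real_derivative D * D') (at 0)"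
    by (rule DERIV_chain2[where g = "\<lambda>h. f (x + h *\<^sub>R axis k 1)", rotated]) (simp add: assms(1))
  then show ?thesis
    unfolding pdiff_def has_partial_def by blast
qed

lemmas pdiff_sin = pdiff_chain[OF DERIV_sin] and pdiff_cos = pdiff_chain[OF DERIV_cos]

lemmas pdiff_rules = pdiff_intros pdiff_minus pdiff_diff pdiff_power pdiff_divide pdiff_component
  pdiff_sin pdiff_cos

lemma matrix_inv_eqI:
  fixes A :: "'a::field ^ 'n::finite ^ 'n"
  assumes "A ** B = mat 1"
  shows "matrix_inv A = B"
proof -
  have BA: "B ** A = mat 1"
    using assms by (simp add: matrix_left_right_inverse)
  have "A ** matrix_inv A = mat 1"
    using assms BA unfolding matrix_inv_def by (metis (mono_tags, lifting) someI_ex)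
  then have "B ** (A ** matrix_inv A) = B"
    by simp
  then show ?thesis
    by (simp add: matrix_mul_assoc BA)
qed

section \<open>Curvature in a moving frame\<close>

text \<open>
  An orthogonal frame \<open>e\<^sub>a\<close> with dual coframe \<open>\<theta>\<^sup>a\<close>, squared lengths \<open>h a\<close> and connection
  coefficients \<open>G a b c = \<theta>\<^sup>a(\<nabla>\<^bsub>b\<^esub> e\<^sub>c)\<close>.
\<close>

locale moving_frame =
  fixes g :: "'n::finite metric" and U :: "(real ^ 'n) set"
    and \<theta> e :: "'n \<Rightarrow> 'n \<Rightarrow> real ^ 'n \<Rightarrow> real"
    and h :: "'n \<Rightarrow> real ^ 'n \<Rightarrow> real"
    and G :: "'n \<Rightarrow> 'n \<Rightarrow> 'n \<Rightarrow> real ^ 'n \<Rightarrow> real"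
  assumes open_U: "open U"
    and metric: "x \<in> U \<Longrightarrow> g x $ i $ j = (\<Sum>a\<in>UNIV. h a x * \<theta> a i x * \<theta> a j x)"
    and h_nonzero: "x \<in> U \<Longrightarrow> h a x \<noteq> 0"
    and dual: "x \<in> U \<Longrightarrow> (\<Sum>k\<in>UNIV. \<theta> a k x * e b k x) = (if a = b then 1 else 0)"
    and pdiff_coframe: "x \<in> U \<Longrightarrow> pdiff k (\<theta> a i) x"
    and pdiff_partial_coframe: "x \<in> U \<Longrightarrow> pdiff k (partial l (\<theta> a i)) x"
    and partial_commute: "x \<in> U \<Longrightarrow> partial k (partial l (\<theta> a i)) x = partial l (partial k (\<theta> a i)) x"
    and pdiff_frame: "x \<in> U \<Longrightarrow> pdiff k (e a i) x"
    and pdiff_h: "x \<in> U \<Longrightarrow> pdiff k (h a) x"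
    and pdiff_G: "x \<in> U \<Longrightarrow> pdiff k (G a b c) x"
    and metricity: "x \<in> U \<Longrightarrow>
      (if a = b then \<Sum>k\<in>UNIV. e c k x * partial k (h a) x else 0) = h b x * G b c a x + h a x * G a c b x"
    and torsion: "x \<in> U \<Longrightarrow> partial k (\<theta> c l) x - partial l (\<theta> c k) x
      = (\<Sum>a\<in>UNIV. \<Sum>b\<in>UNIV. G c a b x * (\<theta> a l x * \<theta> b k x - \<theta> a k x * \<theta> b l x))"
begin

definition frame_deriv :: "'n \<Rightarrow> (real ^ 'n \<Rightarrow> real) \<Rightarrow> real ^ 'n \<Rightarrow> real" where
  "frame_deriv a f x = (\<Sum>k\<in>UNIV. e a k x * partial k f x)"

text \<open>The connection one-form omega^a_b evaluated on coordinate vectors. Objects with both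
  frame and coordinate indices mediate between the frame data and the coordinate definitions of
  \<open>christoffel\<close> and \<open>riemann\<close>.\<close>

definition conn_form :: "'n \<Rightarrow> 'n \<Rightarrow> 'n \<Rightarrow> real ^ 'n \<Rightarrow> real" where
  "conn_form a b k x = (\<Sum>c\<in>UNIV. \<theta> c k x * G a c b x)"

text \<open>The last term subtracts the derivative along the commutator of e_c and e_d, whose
  components are \<open>G f c d - G f d c\<close> because the torsion vanishes. The factor
  \<open>h a\<close> lowers the first index.\<close>

definition frame_riemann :: "'n \<Rightarrow> 'n \<Rightarrow> 'n \<Rightarrow> 'n \<Rightarrow> real ^ 'n \<Rightarrow> real" where
  "frame_riemann a b c d x = h a x * (frame_deriv c (G a d b) x - frame_deriv d (G a c b) x
     + (\<Sum>f\<in>UNIV. G a c f x * G f d b x - G a d f x * G f c b x - (G f c d x - G f d c x) * G a f b x))"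

definition frame_nabla4 ::
  "('n \<Rightarrow> 'n \<Rightarrow> 'n \<Rightarrow> 'n \<Rightarrow> real ^ 'n \<Rightarrow> real) \<Rightarrow> 'n \<Rightarrow> 'n \<Rightarrow> 'n \<Rightarrow> 'n \<Rightarrow> 'n \<Rightarrow> real ^ 'n \<Rightarrow> real" where
  "frame_nabla4 T f a b c d x = frame_deriv f (T a b c d) x
     - (\<Sum>p\<in>UNIV. G p f a x * T p b c d x) - (\<Sum>p\<in>UNIV. G p f b x * T a p c d x)
     - (\<Sum>p\<in>UNIV. G p f c x * T a b p d x) - (\<Sum>p\<in>UNIV. G p f d x * T a b c p x)"

lemma dual':
  assumes "x \<in> U"
  shows "(\<Sum>a\<in>UNIV. e a i x * \<theta> a j x) = (if i = j then 1 else 0)"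
proof -
  define A :: "real ^ 'n ^ 'n" where "A = (\<chi> a k. \<theta> a k x)"
  define B :: "real ^ 'n ^ 'n" where "B = (\<chi> k b. e b k x)"
  have "A ** B = mat 1"
    using dual[OF assms] by (simp add: A_def B_def matrix_matrix_mult_def mat_def vec_eq_iff)
  then have "B ** A = mat 1"
    by (simp add: matrix_left_right_inverse)
  then show ?thesis
    by (simp add: A_def B_def matrix_matrix_mult_def mat_def vec_eq_iff)
qed

lemma expand_coframe:
  assumes "x \<in> U"
  shows "(\<Sum>a\<in>UNIV. \<theta> a i x * (\<Sum>k\<in>UNIV. e a k x * v k)) = v i"
proof -
  have "(\<Sum>a\<in>UNIV. \<theta> a i x * (\<Sum>k\<in>UNIV. e a k x * v k))
      = (\<Sum>k\<in>UNIV. (\<Sum>a\<in>UNIV. e a k x * \<theta> a i x) * v k)"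
    unfolding sum_distrib_left sum_distrib_right by (subst sum.swap) (simp add: mult_ac)
  also have "\<dots> = v i"
    by (simp add: dual'[OF assms] if_distrib[of "\<lambda>u. u * _"] cong: if_cong)
  finally show ?thesis .
qed

lemma expand_frame:
  assumes "x \<in> U"
  shows "(\<Sum>k\<in>UNIV. \<theta> a k x * (\<Sum>b\<in>UNIV. e b k x * v b)) = v a"
proof -
  have "(\<Sum>k\<in>UNIV. \<theta> a k x * (\<Sum>b\<in>UNIV. e b k x * v b))
      = (\<Sum>b\<in>UNIV. (\<Sum>k\<in>UNIV. \<theta> a k x * e b k x) * v b)"
    unfolding sum_distrib_left sum_distrib_right by (subst sum.swap) (simp add: mult_ac)
  also have "\<dots> = v a"
    by (simp add: dual[OF assms] if_distrib[of "\<lambda>u. u * _"] cong: if_cong)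
  finally show ?thesis .
qed

lemma contract_frame:
  assumes "x \<in> U"
  shows "(\<Sum>k\<in>UNIV. e b k x * (\<Sum>a\<in>UNIV. \<theta> a k x * v a)) = v b"
proof -
  have "(\<Sum>k\<in>UNIV. e b k x * (\<Sum>a\<in>UNIV. \<theta> a k x * v a))
      = (\<Sum>a\<in>UNIV. (\<Sum>k\<in>UNIV. \<theta> a k x * e b k x) * v a)"
    unfolding sum_distrib_left sum_distrib_right by (subst sum.swap) (simp add: mult_ac)
  also have "\<dots> = v b"
    by (simp add: dual[OF assms] if_distrib[of "\<lambda>u. u * _"] cong: if_cong)
  finally show ?thesis .
qed

lemma partial_frame_deriv:
  "x \<in> U \<Longrightarrow> partial k f x = (\<Sum>a\<in>UNIV. \<theta> a k x * frame_deriv a f x)"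
  by (simp add: frame_deriv_def expand_coframe)

lemma inv_metric_frame:
  assumes "x \<in> U"
  shows "inv_metric g i j x = (\<Sum>a\<in>UNIV. e a i x * (e a j x / h a x))"
proof -
  define B :: "real ^ 'n ^ 'n" where "B = (\<chi> i j. \<Sum>a\<in>UNIV. e a i x * (e a j x / h a x))"
  have "(\<Sum>k\<in>UNIV. g x $ i $ k * B $ k $ j) = (if i = j then 1 else 0)" for i j
  proof -
    have "(\<Sum>k\<in>UNIV. g x $ i $ k * B $ k $ j)
      = (\<Sum>a\<in>UNIV. h a x * \<theta> a i x * (\<Sum>k\<in>UNIV. \<theta> a k x * (\<Sum>b\<in>UNIV. e b k x * (e b j x / h b x))))"
      unfolding metric[OF assms] B_def sum_distrib_right
      by (simp, subst sum.swap) (simp add: sum_distrib_left mult_ac)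
    also have "\<dots> = (\<Sum>a\<in>UNIV. e a j x * \<theta> a i x)"
      unfolding expand_frame[OF assms] by (simp add: h_nonzero[OF assms] mult_ac)
    finally show ?thesis
      by (auto simp: dual'[OF assms])
  qed
  then have "g x ** B = mat 1"
    by (simp add: matrix_matrix_mult_def mat_def vec_eq_iff)
  then have "matrix_inv (g x) = B"
    by (rule matrix_inv_eqI)
  then show ?thesis
    by (simp add: inv_metric_def B_def)
qed

section \<open>Connection forms and the Levi-Civita connection\<close>

lemma pdiff_conn_form: "x \<in> U \<Longrightarrow> pdiff k (conn_form a b l) x"
  unfolding conn_form_def[abs_def] by (intro pdiff_intros pdiff_coframe pdiff_G)

text \<open>The covariant derivative of the coframe that corrects only the frame index. Since the
  derivative corrected in both indices vanishes, it has to agree with the Christoffel term, as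
  \<open>coframe_christoffel\<close> confirms.\<close>

definition nabla_coframe :: "'n \<Rightarrow> 'n \<Rightarrow> 'n \<Rightarrow> real ^ 'n \<Rightarrow> real" where
  "nabla_coframe a j k x = partial j (\<theta> a k) x + (\<Sum>b\<in>UNIV. conn_form a b j x * \<theta> b k x)"

lemma torsion_form:
  assumes "x \<in> U"
  shows "partial k (\<theta> c l) x - partial l (\<theta> c k) x
      = (\<Sum>b\<in>UNIV. conn_form c b l x * \<theta> b k x - conn_form c b k x * \<theta> b l x)"
  unfolding torsion[OF assms] conn_form_def sum_distrib_right sum_subtractf[symmetric]
  by (subst sum.swap) (simp add: algebra_simps)

lemma nabla_coframe_sym: "x \<in> U \<Longrightarrow> nabla_coframe a j k x = nabla_coframe a k j x"
  using torsion_form[of x j a k] by (simp add: nabla_coframe_def sum_subtractf)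

lemma metricity_form:
  assumes "x \<in> U"
  shows "h b x * conn_form b a k x + h a x * conn_form a b k x = (if a = b then partial k (h a) x else 0)"
proof -
  have "h b x * conn_form b a k x + h a x * conn_form a b k x
      = (\<Sum>c\<in>UNIV. \<theta> c k x * (h b x * G b c a x + h a x * G a c b x))"
    by (simp add: conn_form_def sum_distrib_left sum.distrib algebra_simps)
  also have "\<dots> = (if a = b then partial k (h a) x else 0)"
    using expand_coframe[OF assms, of k "\<lambda>k. partial k (h a) x"]
    unfolding metricity[OF assms, symmetric] by (cases "a = b") auto
  finally show ?thesis .
qed

lemma partial_metric:
  assumes x: "x \<in> U"
  shows "partial k (\<lambda>y. g y $ i $ j) x
    = (\<Sum>a\<in>UNIV. h a x * (nabla_coframe a k i x * \<theta> a j x + \<theta> a i x * nabla_coframe a k j x))"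
proof -
  have "partial k (\<lambda>y. g y $ i $ j) x = partial k (\<lambda>y. \<Sum>a\<in>UNIV. h a y * \<theta> a i y * \<theta> a j y) x"
    by (rule partial_cong[OF open_U x metric])
  also have "\<dots> = (\<Sum>a\<in>UNIV. partial k (h a) x * (\<theta> a i x * \<theta> a j x))
      + (\<Sum>a\<in>UNIV. h a x * (partial k (\<theta> a i) x * \<theta> a j x + \<theta> a i x * partial k (\<theta> a j) x))"
    by (simp add: partial_sum partial_mult pdiff_mult pdiff_h pdiff_coframe x sum.distrib[symmetric] algebra_simps)
  \<comment> \<open>The diagonal sum becomes a double sum with a Kronecker delta so that the
    off-diagonal cases of \<open>metricity_form\<close> can be used too. The two connection terms
    they supply complete the derivatives of the coframe to \<open>nabla_coframe\<close>.\<close>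
  also have "(\<Sum>a\<in>UNIV. partial k (h a) x * (\<theta> a i x * \<theta> a j x))
      = (\<Sum>a\<in>UNIV. \<Sum>b\<in>UNIV. (if a = b then partial k (h a) x else 0) * (\<theta> a i x * \<theta> b j x))"
    by (simp add: if_distrib[of "\<lambda>u. u * _"] cong: if_cong)
  also have "\<dots> = (\<Sum>a\<in>UNIV. \<Sum>b\<in>UNIV. h b x * conn_form b a k x * \<theta> a i x * \<theta> b j x)
       + (\<Sum>a\<in>UNIV. \<Sum>b\<in>UNIV. h a x * conn_form a b k x * \<theta> a i x * \<theta> b j x)"
    unfolding metricity_form[OF x, symmetric] by (simp add: sum.distrib algebra_simps)
  also have "(\<Sum>a\<in>UNIV. \<Sum>b\<in>UNIV. h b x * conn_form b a k x * \<theta> a i x * \<theta> b j x)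
      = (\<Sum>b\<in>UNIV. \<Sum>a\<in>UNIV. h b x * conn_form b a k x * \<theta> a i x * \<theta> b j x)"
    by (rule sum.swap)
  finally show ?thesis
    by (simp add: nabla_coframe_def sum.distrib sum_distrib_left sum_distrib_right algebra_simps)
qed

text \<open>The Koszul cancellation: \<open>partial_metric\<close> turns the three metric
  derivatives into six terms, and the symmetry of \<open>nabla_coframe\<close> in its coordinate
  indices, which is vanishing torsion, cancels four of them and identifies the other two.\<close>

lemma christoffel_frame:
  assumes x: "x \<in> U"
  shows "christoffel g i j k x = (\<Sum>a\<in>UNIV. e a i x * nabla_coframe a j k x)"
proof -
  have "partial j (\<lambda>y. g y $ l $ k) x + partial k (\<lambda>y. g y $ l $ j) x - partial l (\<lambda>y. g y $ j $ k) x
     = 2 * (\<Sum>a\<in>UNIV. \<theta> a l x * (h a x * nabla_coframe a j k x))" for l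
    unfolding partial_metric[OF x] sum_distrib_left sum.distrib[symmetric] sum_subtractf[symmetric]
      nabla_coframe_sym[OF x, of _ l] nabla_coframe_sym[OF x, of _ k j]
    by (simp add: algebra_simps)
  then have "christoffel g i j k x
    = (\<Sum>l\<in>UNIV. (\<Sum>b\<in>UNIV. e b i x * (e b l x / h b x)) * (\<Sum>a\<in>UNIV. \<theta> a l x * (h a x * nabla_coframe a j k x)))"
    by (simp add: christoffel_def inv_metric_frame[OF x] sum_distrib_left)
  also have "\<dots> = (\<Sum>b\<in>UNIV. e b i x / h b x * (\<Sum>l\<in>UNIV. e b l x * (\<Sum>a\<in>UNIV. \<theta> a l x * (h a x * nabla_coframe a j k x))))"
    unfolding sum_distrib_right by (subst sum.swap) (simp add: sum_distrib_left mult_ac)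
  also have "\<dots> = (\<Sum>b\<in>UNIV. e b i x / h b x * (h b x * nabla_coframe b j k x))"
    unfolding contract_frame[OF x] ..
  finally show ?thesis
    by (simp add: h_nonzero[OF x])
qed

lemma coframe_christoffel:
  assumes x: "x \<in> U"
  shows "(\<Sum>i\<in>UNIV. \<theta> a i x * christoffel g i j k x) = nabla_coframe a j k x"
  unfolding christoffel_frame[OF x] by (rule expand_frame[OF x])

lemma pdiff_nabla_coframe: "x \<in> U \<Longrightarrow> pdiff l (nabla_coframe a j k) x"
  unfolding nabla_coframe_def[abs_def]
  by (intro pdiff_intros pdiff_coframe pdiff_partial_coframe pdiff_conn_form)

lemma pdiff_christoffel:
  assumes "x \<in> U"
  shows "pdiff l (christoffel g i j k) x"
proof -
  have "pdiff l (christoffel g i j k) x \<longleftrightarrow> pdiff l (\<lambda>y. \<Sum>a\<in>UNIV. e a i y * nabla_coframe a j k y) x"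
    by (rule pdiff_cong[OF open_U assms christoffel_frame])
  then show ?thesis
    by (simp add: pdiff_intros pdiff_frame pdiff_nabla_coframe assms)
qed

lemma partial_coframe:
  assumes "x \<in> U"
  shows "partial k (\<theta> a i) x
    = (\<Sum>p\<in>UNIV. \<theta> a p x * christoffel g p k i x) - (\<Sum>b\<in>UNIV. conn_form a b k x * \<theta> b i x)"
  by (simp add: coframe_christoffel[OF assms] nabla_coframe_def)

section \<open>The second structure equation\<close>

definition curv_form :: "'n \<Rightarrow> 'n \<Rightarrow> 'n \<Rightarrow> 'n \<Rightarrow> real ^ 'n \<Rightarrow> real" where
  "curv_form a b k l x = partial k (conn_form a b l) x - partial l (conn_form a b k) x
     + (\<Sum>c\<in>UNIV. conn_form a c k x * conn_form c b l x - conn_form a c l x * conn_form c b k x)"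

lemma riemann_up_curv_form:
  assumes x: "x \<in> U"
  shows "(\<Sum>i\<in>UNIV. \<theta> a i x * riemann_up g i j k l x) = (\<Sum>b\<in>UNIV. curv_form a b k l x * \<theta> b j x)"
proof -
  define \<Gamma> where "\<Gamma> = christoffel g"
  \<comment> \<open>Half of the contracted curvature, before antisymmetrising in k and l. In its
    expansion the second derivatives of the coframe and the mixed products of connection form and
    coframe derivative are symmetric in k and l and drop out of the difference.\<close>
  define L where "L k l = (\<Sum>i\<in>UNIV. \<theta> a i x * (partial k (\<Gamma> i l j) x + (\<Sum>p\<in>UNIV. \<Gamma> i k p x * \<Gamma> p l j x)))"
    for k l
  have L: "L k l = partial k (partial l (\<theta> a j)) x
      + (\<Sum>b\<in>UNIV. partial k (conn_form a b l) x * \<theta> b j x)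
      + (\<Sum>b\<in>UNIV. conn_form a b l x * partial k (\<theta> b j) x + conn_form a b k x * partial l (\<theta> b j) x)
      + (\<Sum>b\<in>UNIV. (\<Sum>c\<in>UNIV. conn_form a c k x * conn_form c b l x) * \<theta> b j x)" for k l
  proof -
    have "(\<Sum>i\<in>UNIV. partial k (\<theta> a i) x * \<Gamma> i l j x) + (\<Sum>i\<in>UNIV. \<theta> a i x * partial k (\<Gamma> i l j) x)
       = partial k (\<lambda>y. \<Sum>i\<in>UNIV. \<theta> a i y * \<Gamma> i l j y) x"
      by (simp add: \<Gamma>_def partial_sum partial_mult pdiff_mult pdiff_coframe pdiff_christoffel x sum.distrib)
    also have "\<dots> = partial k (nabla_coframe a l j) x"
      unfolding \<Gamma>_def by (rule partial_cong[OF open_U x coframe_christoffel])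
    also have "\<dots> = partial k (partial l (\<theta> a j)) x
        + (\<Sum>b\<in>UNIV. partial k (conn_form a b l) x * \<theta> b j x + conn_form a b l x * partial k (\<theta> b j) x)"
      unfolding nabla_coframe_def[abs_def]
      by (simp add: partial_add partial_sum partial_mult pdiff_intros pdiff_coframe
          pdiff_partial_coframe pdiff_conn_form x)
    finally have "(\<Sum>i\<in>UNIV. \<theta> a i x * partial k (\<Gamma> i l j) x) = \<dots> - (\<Sum>i\<in>UNIV. partial k (\<theta> a i) x * \<Gamma> i l j x)"
      by simp
    \<comment> \<open>Replacing the derivative of the coframe by its Christoffel and connection
      parts is the key: the first cancels the quadratic Christoffel term of \<open>L\<close>, the
      second produces the quadratic term in the connection forms.\<close>
    moreover have "(\<Sum>i\<in>UNIV. partial k (\<theta> a i) x * \<Gamma> i l j x)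
        = (\<Sum>i\<in>UNIV. \<Sum>p\<in>UNIV. \<theta> a p x * \<Gamma> p k i x * \<Gamma> i l j x)
          - (\<Sum>i\<in>UNIV. \<Sum>b\<in>UNIV. conn_form a b k x * \<theta> b i x * \<Gamma> i l j x)"
      by (simp add: partial_coframe[OF x] \<Gamma>_def sum_distrib_right sum_subtractf left_diff_distrib)
    moreover have "(\<Sum>i\<in>UNIV. \<Sum>p\<in>UNIV. \<theta> a p x * \<Gamma> p k i x * \<Gamma> i l j x)
        = (\<Sum>i\<in>UNIV. \<theta> a i x * (\<Sum>p\<in>UNIV. \<Gamma> i k p x * \<Gamma> p l j x))"
      by (subst sum.swap) (simp add: sum_distrib_left mult_ac)
    moreover have "(\<Sum>i\<in>UNIV. \<Sum>b\<in>UNIV. conn_form a b k x * \<theta> b i x * \<Gamma> i l j x)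
        = (\<Sum>b\<in>UNIV. conn_form a b k x * nabla_coframe b l j x)"
      unfolding coframe_christoffel[OF x, symmetric] \<Gamma>_def
      by (subst sum.swap) (simp add: sum_distrib_left mult_ac)
    moreover have "(\<Sum>b\<in>UNIV. conn_form a b k x * nabla_coframe b l j x)
      = (\<Sum>b\<in>UNIV. conn_form a b k x * partial l (\<theta> b j) x)
        + (\<Sum>c\<in>UNIV. \<Sum>b\<in>UNIV. conn_form a c k x * conn_form c b l x * \<theta> b j x)"
      by (simp add: nabla_coframe_def distrib_left sum.distrib sum_distrib_left mult.assoc)
    moreover have "(\<Sum>c\<in>UNIV. \<Sum>b\<in>UNIV. conn_form a c k x * conn_form c b l x * \<theta> b j x)
      = (\<Sum>b\<in>UNIV. (\<Sum>c\<in>UNIV. conn_form a c k x * conn_form c b l x) * \<theta> b j x)"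
      by (subst sum.swap) (simp add: sum_distrib_right)
    ultimately show ?thesis
      by (simp add: L_def distrib_left sum.distrib)
  qed
  have "(\<Sum>i\<in>UNIV. \<theta> a i x * riemann_up g i j k l x) = L k l - L l k"
    by (simp add: L_def \<Gamma>_def riemann_up_def sum_subtractf[symmetric] algebra_simps)
  also have "\<dots> = (\<Sum>b\<in>UNIV. curv_form a b k l x * \<theta> b j x)"
    unfolding L partial_commute[OF x, of l k] curv_form_def
    by (simp add: sum.distrib sum_subtractf algebra_simps)
  finally show ?thesis .
qed

text \<open>Differentiating a connection form also differentiates the coframe factors in it.
  Vanishing torsion turns these derivatives into the commutator term of
  \<open>frame_riemann\<close>.\<close>

lemma curv_form_frame:
  assumes x: "x \<in> U"
  shows "h a x * curv_form a b k l x
    = (\<Sum>c\<in>UNIV. \<theta> c k x * (\<Sum>d\<in>UNIV. \<theta> d l x * frame_riemann a b c d x))"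
proof -
  have dw: "partial k (conn_form a b l) x - partial l (conn_form a b k) x
     = (\<Sum>c\<in>UNIV. \<Sum>d\<in>UNIV. \<theta> c k x * \<theta> d l x * (frame_deriv c (G a d b) x - frame_deriv d (G a c b) x))
       - (\<Sum>f\<in>UNIV. \<Sum>c\<in>UNIV. \<Sum>d\<in>UNIV. \<theta> c k x * \<theta> d l x * ((G f c d x - G f d c x) * G a f b x))"
  proof -
    have w: "partial k (conn_form a b l) x = (\<Sum>c\<in>UNIV. \<theta> c l x * partial k (G a c b) x + partial k (\<theta> c l) x * G a c b x)"
      for k l
      unfolding conn_form_def[abs_def]
      by (simp add: partial_sum partial_mult pdiff_mult pdiff_coframe pdiff_G x algebra_simps)
    have s: "(\<Sum>c\<in>UNIV. \<theta> c l x * partial k (G a c b) x)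
      = (\<Sum>c\<in>UNIV. \<Sum>d\<in>UNIV. \<theta> c k x * \<theta> d l x * frame_deriv c (G a d b) x)"
      unfolding partial_frame_deriv[OF x, of k] sum_distrib_left
      by (subst sum.swap) (simp add: mult_ac)
    have s': "(\<Sum>c\<in>UNIV. \<theta> c k x * partial l (G a c b) x)
      = (\<Sum>c\<in>UNIV. \<Sum>d\<in>UNIV. \<theta> c k x * \<theta> d l x * frame_deriv d (G a c b) x)"
      unfolding partial_frame_deriv[OF x, of l] sum_distrib_left
      by (simp add: mult_ac)
    have t: "partial k (\<theta> f l) x - partial l (\<theta> f k) x
       = - (\<Sum>c\<in>UNIV. \<Sum>d\<in>UNIV. \<theta> c k x * \<theta> d l x * (G f c d x - G f d c x))" for f
    proof -
      have "(\<Sum>c\<in>UNIV. \<Sum>d\<in>UNIV. \<theta> c k x * \<theta> d l x * G f d c x)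
        = (\<Sum>c\<in>UNIV. \<Sum>d\<in>UNIV. \<theta> d k x * \<theta> c l x * G f c d x)"
        by (rule sum.swap)
      then show ?thesis
        unfolding torsion[OF x] by (simp add: algebra_simps sum_subtractf)
    qed
    have "partial k (conn_form a b l) x - partial l (conn_form a b k) x
      = (\<Sum>c\<in>UNIV. \<theta> c l x * partial k (G a c b) x) - (\<Sum>c\<in>UNIV. \<theta> c k x * partial l (G a c b) x)
        + (\<Sum>f\<in>UNIV. (partial k (\<theta> f l) x - partial l (\<theta> f k) x) * G a f b x)"
      unfolding w by (simp add: sum.distrib sum_subtractf left_diff_distrib)
    moreover have "(\<Sum>f\<in>UNIV. (partial k (\<theta> f l) x - partial l (\<theta> f k) x) * G a f b x)
      = - (\<Sum>f\<in>UNIV. \<Sum>c\<in>UNIV. \<Sum>d\<in>UNIV. \<theta> c k x * \<theta> d l x * ((G f c d x - G f d c x) * G a f b x))"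
      unfolding t by (simp only: sum_distrib_right sum_negf mult_minus_left mult.assoc)
    ultimately show ?thesis
      unfolding s s' by (simp add: sum_subtractf right_diff_distrib)
  qed
  have ww: "(\<Sum>f\<in>UNIV. conn_form a f k x * conn_form f b l x - conn_form a f l x * conn_form f b k x)
     = (\<Sum>f\<in>UNIV. \<Sum>c\<in>UNIV. \<Sum>d\<in>UNIV. \<theta> c k x * \<theta> d l x * (G a c f x * G f d b x - G a d f x * G f c b x))"
  proof (rule sum.cong[OF refl])
    fix f
    have "conn_form f b k x * conn_form a f l x = (\<Sum>c\<in>UNIV. \<Sum>d\<in>UNIV. \<theta> c k x * \<theta> d l x * (G a d f x * G f c b x))"
      by (simp add: conn_form_def sum_product mult_ac)
    then show "conn_form a f k x * conn_form f b l x - conn_form a f l x * conn_form f b k x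
      = (\<Sum>c\<in>UNIV. \<Sum>d\<in>UNIV. \<theta> c k x * \<theta> d l x * (G a c f x * G f d b x - G a d f x * G f c b x))"
      by (simp add: mult.commute[of "conn_form a f l x"] right_diff_distrib sum_subtractf)
        (simp add: conn_form_def sum_product mult_ac)
  qed
  have swap3: "(\<Sum>f\<in>UNIV. \<Sum>c\<in>UNIV. \<Sum>d\<in>UNIV. \<theta> c k x * \<theta> d l x * v f c d)
      = (\<Sum>c\<in>UNIV. \<Sum>d\<in>UNIV. \<theta> c k x * \<theta> d l x * (\<Sum>f\<in>UNIV. v f c d))" for v :: "'n \<Rightarrow> 'n \<Rightarrow> 'n \<Rightarrow> real"
    unfolding sum_distrib_left
    by (subst sum.swap) (rule sum.cong[OF refl], rule sum.swap)
  show ?thesis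
    unfolding curv_form_def dw ww swap3 frame_riemann_def sum_distrib_left
      sum_subtractf[symmetric] sum.distrib[symmetric]
    by (simp add: sum_distrib_left sum_subtractf sum.distrib algebra_simps)
qed

lemma riemann_frame:
  assumes x: "x \<in> U"
  shows "riemann g i j k l x = (\<Sum>a\<in>UNIV. \<theta> a i x * (\<Sum>b\<in>UNIV. \<theta> b j x *
     (\<Sum>c\<in>UNIV. \<theta> c k x * (\<Sum>d\<in>UNIV. \<theta> d l x * frame_riemann a b c d x))))"
proof -
  have "riemann g i j k l x = (\<Sum>a\<in>UNIV. h a x * \<theta> a i x * (\<Sum>p\<in>UNIV. \<theta> a p x * riemann_up g p j k l x))"
    unfolding riemann_def metric[OF x] sum_distrib_right
    by (subst sum.swap) (simp add: sum_distrib_left mult_ac)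
  also have "\<dots> = (\<Sum>a\<in>UNIV. \<theta> a i x * (\<Sum>b\<in>UNIV. \<theta> b j x * (h a x * curv_form a b k l x)))"
    unfolding riemann_up_curv_form[OF x] by (simp add: sum_distrib_left mult_ac)
  finally show ?thesis
    unfolding curv_form_frame[OF x] .
qed

section \<open>Covariant derivative and full contraction in the frame\<close>

lemma push_sum:
  fixes v :: "'i \<Rightarrow> real"
  shows "(\<Sum>p\<in>P. v p * (\<Sum>a\<in>A. t a * z a p)) = (\<Sum>a\<in>A. t a * (\<Sum>p\<in>P. v p * z a p))"
  unfolding sum_distrib_left by (subst sum.swap) (simp add: mult_ac)

text \<open>The derivative of the coframe is a Christoffel term minus a connection-form term. The
  former cancels the correction for the coordinate index, the latter becomes the correction for the
  frame index. It is stated for a single index, the other indices being parameters.\<close>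

lemma nabla_lower:
  assumes x: "x \<in> U"
    and T: "\<And>y i. y \<in> U \<Longrightarrow> T i y = (\<Sum>a\<in>UNIV. \<theta> a i y * S a y)"
    and S: "\<And>a. pdiff k (S a) x"
  shows "partial k (T i) x - (\<Sum>p\<in>UNIV. christoffel g p k i x * T p x)
    = (\<Sum>a\<in>UNIV. \<theta> a i x * (partial k (S a) x - (\<Sum>p\<in>UNIV. conn_form p a k x * S p x)))"
proof -
  have "partial k (T i) x = partial k (\<lambda>y. \<Sum>a\<in>UNIV. \<theta> a i y * S a y) x"
    by (rule partial_cong[OF open_U x T])
  also have "\<dots> = (\<Sum>a\<in>UNIV. partial k (\<theta> a i) x * S a x) + (\<Sum>a\<in>UNIV. \<theta> a i x * partial k (S a) x)"
    by (simp add: partial_sum partial_mult pdiff_mult pdiff_coframe S x sum.distrib)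
  also have "(\<Sum>a\<in>UNIV. partial k (\<theta> a i) x * S a x)
     = (\<Sum>a\<in>UNIV. S a x * (\<Sum>p\<in>UNIV. christoffel g p k i x * \<theta> a p x))
       - (\<Sum>a\<in>UNIV. S a x * (\<Sum>b\<in>UNIV. \<theta> b i x * conn_form a b k x))"
    by (simp add: partial_coframe[OF x] left_diff_distrib right_diff_distrib sum_subtractf mult_ac)
  also have "(\<Sum>a\<in>UNIV. S a x * (\<Sum>p\<in>UNIV. christoffel g p k i x * \<theta> a p x))
     = (\<Sum>p\<in>UNIV. christoffel g p k i x * T p x)"
    unfolding T[OF x] by (subst push_sum) (simp add: mult_ac)
  also have "(\<Sum>a\<in>UNIV. S a x * (\<Sum>b\<in>UNIV. \<theta> b i x * conn_form a b k x))
     = (\<Sum>b\<in>UNIV. \<theta> b i x * (\<Sum>a\<in>UNIV. conn_form a b k x * S a x))"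
    by (subst push_sum) (simp add: mult_ac)
  finally show ?thesis
    by (simp add: right_diff_distrib sum_subtractf)
qed

text \<open>One application of \<open>nabla_lower\<close> per index, from the left: in
  \<open>S1\<close>, \<open>S2\<close>, \<open>S3\<close> the first one, two, three indices already
  refer to the frame, and \<open>push\<close> carries the corrections for the remaining indices
  through the sums outside them.\<close>

lemma cov_deriv4_frame:
  assumes x: "x \<in> U"
    and T: "\<And>y i j k l. y \<in> U \<Longrightarrow> T i j k l y = (\<Sum>a\<in>UNIV. \<theta> a i y * (\<Sum>b\<in>UNIV. \<theta> b j y *
         (\<Sum>c\<in>UNIV. \<theta> c k y * (\<Sum>d\<in>UNIV. \<theta> d l y * R a b c d y))))"
    and R: "\<And>a b c d k. pdiff k (R a b c d) x"
  shows "cov_deriv4 g T \<mu> i j k l x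
    = (\<Sum>f\<in>UNIV. \<theta> f \<mu> x * (\<Sum>a\<in>UNIV. \<theta> a i x * (\<Sum>b\<in>UNIV. \<theta> b j x *
         (\<Sum>c\<in>UNIV. \<theta> c k x * (\<Sum>d\<in>UNIV. \<theta> d l x * frame_nabla4 R f a b c d x)))))"
proof -
  define S3 where "S3 a b c l y = (\<Sum>d\<in>UNIV. \<theta> d l y * R a b c d y)" for a b c l y
  define S2 where "S2 a b k l y = (\<Sum>c\<in>UNIV. \<theta> c k y * S3 a b c l y)" for a b k l y
  define S1 where "S1 a j k l y = (\<Sum>b\<in>UNIV. \<theta> b j y * S2 a b k l y)" for a j k l y
  have T1: "T i j k l y = (\<Sum>a\<in>UNIV. \<theta> a i y * S1 a j k l y)" if "y \<in> U" for i j k l y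
    by (simp add: T[OF that] S1_def S2_def S3_def)
  have d3: "pdiff m (S3 a b c l) x" for a b c l m
    unfolding S3_def[abs_def] by (intro pdiff_intros pdiff_coframe R x)
  have d2: "pdiff m (S2 a b c l) x" for a b c l m
    unfolding S2_def[abs_def] by (intro pdiff_intros pdiff_coframe d3 x)
  have d1: "pdiff m (S1 a b c l) x" for a b c l m
    unfolding S1_def[abs_def] by (intro pdiff_intros pdiff_coframe d2 x)
  note lin = right_diff_distrib sum_subtractf
  let ?\<Gamma> = "\<lambda>p i. christoffel g p \<mu> i x" and ?w = "\<lambda>p a. conn_form p a \<mu> x"
  have push: "(\<Sum>p\<in>UNIV. ?\<Gamma> p j * (\<Sum>a\<in>UNIV. \<theta> a i x * z a p)) = (\<Sum>a\<in>UNIV. \<theta> a i x * (\<Sum>p\<in>UNIV. ?\<Gamma> p j * z a p))"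
    "(\<Sum>p\<in>UNIV. ?w p b * (\<Sum>a\<in>UNIV. \<theta> a i x * z a p)) = (\<Sum>a\<in>UNIV. \<theta> a i x * (\<Sum>p\<in>UNIV. ?w p b * z a p))"
    for i j b z
    by (rule push_sum)+
  have st1: "cov_deriv4 g T \<mu> i j k l x = (\<Sum>a\<in>UNIV. \<theta> a i x * (partial \<mu> (S1 a j k l) x
      - (\<Sum>p\<in>UNIV. ?w p a * S1 p j k l x) - (\<Sum>p\<in>UNIV. ?\<Gamma> p j * S1 a p k l x)
      - (\<Sum>p\<in>UNIV. ?\<Gamma> p k * S1 a j p l x) - (\<Sum>p\<in>UNIV. ?\<Gamma> p l * S1 a j k p x)))"
  proof -
    have "partial \<mu> (T i j k l) x - (\<Sum>p\<in>UNIV. ?\<Gamma> p i * T p j k l x)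
      = (\<Sum>a\<in>UNIV. \<theta> a i x * (partial \<mu> (S1 a j k l) x - (\<Sum>p\<in>UNIV. ?w p a * S1 p j k l x)))"
      by (rule nabla_lower[of x "\<lambda>i. T i j k l" "\<lambda>a. S1 a j k l", OF x T1 d1])
    moreover have "(\<Sum>p\<in>UNIV. ?\<Gamma> p j * T i p k l x) = (\<Sum>a\<in>UNIV. \<theta> a i x * (\<Sum>p\<in>UNIV. ?\<Gamma> p j * S1 a p k l x))"
      "(\<Sum>p\<in>UNIV. ?\<Gamma> p k * T i j p l x) = (\<Sum>a\<in>UNIV. \<theta> a i x * (\<Sum>p\<in>UNIV. ?\<Gamma> p k * S1 a j p l x))"
      "(\<Sum>p\<in>UNIV. ?\<Gamma> p l * T i j k p x) = (\<Sum>a\<in>UNIV. \<theta> a i x * (\<Sum>p\<in>UNIV. ?\<Gamma> p l * S1 a j k p x))"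
      by (simp_all only: T1[OF x] push)
    ultimately show ?thesis
      unfolding cov_deriv4_def by (simp only: lin)
  qed
  have st2: "partial \<mu> (S1 a j k l) x
      - (\<Sum>p\<in>UNIV. ?w p a * S1 p j k l x) - (\<Sum>p\<in>UNIV. ?\<Gamma> p j * S1 a p k l x)
      - (\<Sum>p\<in>UNIV. ?\<Gamma> p k * S1 a j p l x) - (\<Sum>p\<in>UNIV. ?\<Gamma> p l * S1 a j k p x)
    = (\<Sum>b\<in>UNIV. \<theta> b j x * (partial \<mu> (S2 a b k l) x - (\<Sum>p\<in>UNIV. ?w p a * S2 p b k l x)
      - (\<Sum>p\<in>UNIV. ?w p b * S2 a p k l x)
      - (\<Sum>p\<in>UNIV. ?\<Gamma> p k * S2 a b p l x) - (\<Sum>p\<in>UNIV. ?\<Gamma> p l * S2 a b k p x)))" for a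
    using nabla_lower[of x "\<lambda>j. S1 a j k l" "\<lambda>b. S2 a b k l" \<mu> j, OF x S1_def d2]
    unfolding S1_def push by (simp add: lin)
  have st3: "partial \<mu> (S2 a b k l) x - (\<Sum>p\<in>UNIV. ?w p a * S2 p b k l x)
      - (\<Sum>p\<in>UNIV. ?w p b * S2 a p k l x)
      - (\<Sum>p\<in>UNIV. ?\<Gamma> p k * S2 a b p l x) - (\<Sum>p\<in>UNIV. ?\<Gamma> p l * S2 a b k p x)
    = (\<Sum>c\<in>UNIV. \<theta> c k x * (partial \<mu> (S3 a b c l) x - (\<Sum>p\<in>UNIV. ?w p a * S3 p b c l x)
      - (\<Sum>p\<in>UNIV. ?w p b * S3 a p c l x) - (\<Sum>p\<in>UNIV. ?w p c * S3 a b p l x)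
      - (\<Sum>p\<in>UNIV. ?\<Gamma> p l * S3 a b c p x)))" for a b
    using nabla_lower[of x "\<lambda>k. S2 a b k l" "\<lambda>c. S3 a b c l" \<mu> k, OF x S2_def d3]
    unfolding S2_def push by (simp add: lin)
  have st4: "partial \<mu> (S3 a b c l) x - (\<Sum>p\<in>UNIV. ?w p a * S3 p b c l x)
      - (\<Sum>p\<in>UNIV. ?w p b * S3 a p c l x) - (\<Sum>p\<in>UNIV. ?w p c * S3 a b p l x)
      - (\<Sum>p\<in>UNIV. ?\<Gamma> p l * S3 a b c p x)
    = (\<Sum>d\<in>UNIV. \<theta> d l x * (partial \<mu> (R a b c d) x - (\<Sum>p\<in>UNIV. ?w p a * R p b c d x)
      - (\<Sum>p\<in>UNIV. ?w p b * R a p c d x) - (\<Sum>p\<in>UNIV. ?w p c * R a b p d x)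
      - (\<Sum>p\<in>UNIV. ?w p d * R a b c p x)))" for a b c
    using nabla_lower[of x "\<lambda>l. S3 a b c l" "\<lambda>d. R a b c d" \<mu> l, OF x S3_def R]
    unfolding S3_def push by (simp add: lin)
  have st5: "partial \<mu> (R a b c d) x - (\<Sum>p\<in>UNIV. ?w p a * R p b c d x)
      - (\<Sum>p\<in>UNIV. ?w p b * R a p c d x) - (\<Sum>p\<in>UNIV. ?w p c * R a b p d x)
      - (\<Sum>p\<in>UNIV. ?w p d * R a b c p x) = (\<Sum>f\<in>UNIV. \<theta> f \<mu> x * frame_nabla4 R f a b c d x)" for a b c d
  proof -
    have w: "(\<Sum>p\<in>UNIV. ?w p a * V p) = (\<Sum>f\<in>UNIV. \<theta> f \<mu> x * (\<Sum>p\<in>UNIV. G p f a x * V p))" for a V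
    proof -
      have "(\<Sum>p\<in>UNIV. ?w p a * V p) = (\<Sum>p\<in>UNIV. V p * (\<Sum>f\<in>UNIV. \<theta> f \<mu> x * G p f a x))"
        by (simp add: conn_form_def mult.commute)
      then show ?thesis
        by (subst (asm) push_sum) (simp add: mult.commute)
    qed
    show ?thesis
      unfolding w partial_frame_deriv[OF x] frame_nabla4_def by (simp add: lin)
  qed
  show ?thesis
    unfolding st1 st2 st3 st4 st5
    unfolding push_sum[where v = "\<lambda>d. \<theta> d l x" and t = "\<lambda>f. \<theta> f \<mu> x"] push_sum[where v = "\<lambda>d. \<theta> d k x" and t = "\<lambda>f. \<theta> f \<mu> x"]
      push_sum[where v = "\<lambda>d. \<theta> d j x" and t = "\<lambda>f. \<theta> f \<mu> x"] push_sum[where v = "\<lambda>d. \<theta> d i x" and t = "\<lambda>f. \<theta> f \<mu> x"] ..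
qed

lemma karlhede_frame:
  assumes x: "x \<in> U" and R: "\<And>a b c d k. pdiff k (frame_riemann a b c d) x"
  shows "karlhede g x = (\<Sum>f\<in>UNIV. \<Sum>a\<in>UNIV. \<Sum>b\<in>UNIV. \<Sum>c\<in>UNIV. \<Sum>d\<in>UNIV.
    (frame_nabla4 frame_riemann f a b c d x)\<^sup>2 / (h f x * h a x * h b x * h c x * h d x))"
proof -
  define N where "N f a b c d = frame_nabla4 frame_riemann f a b c d x" for f a b c d
  define D where "D i j k l m = cov_deriv4 g (riemann g) i j k l m x" for i j k l m
  \<comment> \<open>Raising an index and summing over one are kept as opaque linear operators, so
    the fivefold contraction is carried out one index at a time by rewriting. Raising replaces a
    coframe factor by a frame factor divided by \<open>h\<close>, and duality then leaves only equal
    frame indices.\<close>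
  define raise where "raise i v = (\<Sum>j\<in>UNIV. inv_metric g i j x * v j)" for i v
  define total :: "('n \<Rightarrow> real) \<Rightarrow> real" where "total v = (\<Sum>i\<in>UNIV. v i)" for v
  have D: "D i j k l m = (\<Sum>f\<in>UNIV. \<theta> f i x * (\<Sum>a\<in>UNIV. \<theta> a j x * (\<Sum>b\<in>UNIV. \<theta> b k x *
         (\<Sum>c\<in>UNIV. \<theta> c l x * (\<Sum>d\<in>UNIV. \<theta> d m x * N f a b c d)))))" for i j k l m
    unfolding D_def N_def by (rule cov_deriv4_frame[OF x riemann_frame R])
  have raise_lin: "raise i (\<lambda>j. \<Sum>a\<in>UNIV. t a * v a j) = (\<Sum>a\<in>UNIV. t a * raise i (v a))"
    for i t and v :: "'n \<Rightarrow> 'n \<Rightarrow> real"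
    unfolding raise_def by (rule push_sum)
  have raise_theta: "raise i (\<lambda>j. \<Sum>a\<in>UNIV. \<theta> a j x * v a) = (\<Sum>a\<in>UNIV. (e a i x / h a x) * v a)" for i v
  proof -
    have "raise i (\<lambda>j. \<Sum>a\<in>UNIV. \<theta> a j x * v a)
      = (\<Sum>j\<in>UNIV. (\<Sum>b\<in>UNIV. e b i x / h b x * e b j x) * (\<Sum>a\<in>UNIV. \<theta> a j x * v a))"
      by (simp add: raise_def inv_metric_frame[OF x])
    also have "\<dots> = (\<Sum>b\<in>UNIV. e b i x / h b x * (\<Sum>j\<in>UNIV. e b j x * (\<Sum>a\<in>UNIV. \<theta> a j x * v a)))"
      unfolding sum_distrib_right by (subst sum.swap) (simp add: sum_distrib_left mult.assoc)
    finally show ?thesis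
      unfolding contract_frame[OF x] .
  qed
  have total_lin: "total (\<lambda>i. \<Sum>a\<in>UNIV. \<Sum>b\<in>UNIV. t a b * v a b i) = (\<Sum>a\<in>UNIV. \<Sum>b\<in>UNIV. t a b * total (v a b))"
    for t and v :: "'n \<Rightarrow> 'n \<Rightarrow> 'n \<Rightarrow> real"
    unfolding total_def sum_distrib_left by (subst sum.swap) (rule sum.cong[OF refl], rule sum.swap)
  have total_theta: "total (\<lambda>i. \<Sum>a\<in>UNIV. \<Sum>b\<in>UNIV. (\<theta> a i x * (e b i x / h b x)) * v a b) = (\<Sum>a\<in>UNIV. v a a / h a x)"
    for v
  proof -
    have "total (\<lambda>i. \<Sum>a\<in>UNIV. \<Sum>b\<in>UNIV. (\<theta> a i x * (e b i x / h b x)) * v a b)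
      = (\<Sum>a\<in>UNIV. \<Sum>b\<in>UNIV. (\<Sum>i\<in>UNIV. \<theta> a i x * e b i x) * (v a b / h b x))"
      unfolding total_def sum_distrib_right
      by (subst sum.swap, rule sum.cong[OF refl], subst sum.swap) (simp add: mult_ac)
    also have "\<dots> = (\<Sum>a\<in>UNIV. \<Sum>b\<in>UNIV. if a = b then v a b / h b x else 0)"
      by (intro sum.cong refl) (simp add: dual[OF x])
    finally show ?thesis
      by simp
  qed
  have prod: "(\<Sum>a\<in>UNIV. s a * v a) * (\<Sum>b\<in>UNIV. t b * w b) = (\<Sum>a\<in>UNIV. \<Sum>b\<in>UNIV. (s a * t b) * (v a * w b))"
    for s t v w :: "'n \<Rightarrow> real"
    by (simp add: sum_product mult_ac)
  have "raise5 g (cov_deriv4 g (riemann g)) i j k l m x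
     = raise i (\<lambda>i'. raise j (\<lambda>j'. raise k (\<lambda>k'. raise l (\<lambda>l'. raise m (\<lambda>m'. D i' j' k' l' m')))))" for i j k l m
    by (simp add: raise5_def raise_def D_def sum_distrib_left mult.assoc)
  then have "karlhede g x = total (\<lambda>i. total (\<lambda>j. total (\<lambda>k. total (\<lambda>l. total (\<lambda>m. D i j k l m *
     raise i (\<lambda>i'. raise j (\<lambda>j'. raise k (\<lambda>k'. raise l (\<lambda>l'. raise m (\<lambda>m'. D i' j' k' l' m'))))))))))"
    by (simp add: karlhede_def total_def D_def)
  also have "\<dots> = (\<Sum>f\<in>UNIV. (\<Sum>a\<in>UNIV. (\<Sum>b\<in>UNIV. (\<Sum>c\<in>UNIV. (\<Sum>d\<in>UNIV.
     N f a b c d * N f a b c d / h d x) / h c x) / h b x) / h a x) / h f x)"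
    unfolding D by (simp only: raise_lin raise_theta prod total_lin total_theta)
  also have "\<dots> = (\<Sum>f\<in>UNIV. \<Sum>a\<in>UNIV. \<Sum>b\<in>UNIV. \<Sum>c\<in>UNIV. \<Sum>d\<in>UNIV.
    (N f a b c d)\<^sup>2 / (h f x * h a x * h b x * h c x * h d x))"
    by (simp add: sum_divide_distrib power2_eq_square mult_ac)
  finally show ?thesis
    unfolding N_def .
qed

end

section \<open>Connection and curvature coefficients\<close>

lemmas ring_nf = algebra_simps power2_eq_square power3_eq_cube add_divide_distrib diff_divide_distrib

text \<open>A conditional, so that differentiation passes to the branches for a symbolic index as
  well. The default branch serves the index 4, which is 0 in the type.\<close>

definition pick :: "4 \<Rightarrow> 'b \<Rightarrow> 'b \<Rightarrow> 'b \<Rightarrow> 'b \<Rightarrow> 'b" where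
  "pick i p q s t = (if i = 1 then p else if i = 2 then q else if i = 3 then s else t)"

lemma pick_simps [simp]:
  "pick 1 p q s t = p" "pick 2 p q s t = q" "pick 3 p q s t = s" "pick 4 p q s t = t"
  by (simp_all add: pick_def)

text \<open>The first two scalars are e_2(h_2) / (2 h_2) and e_3(h_3) / (2 h_3); the other four
  describe how \<rho>^2 varies with r and u. The array is linear in the six, so its derivatives have
  the same shape and only scalars need differentiating.\<close>

definition conn :: "real \<Rightarrow> real \<Rightarrow> real \<Rightarrow> real \<Rightarrow> real \<Rightarrow> real \<Rightarrow> real \<Rightarrow> 4 \<Rightarrow> 4 \<Rightarrow> 4 \<Rightarrow> real" where
  "conn a \<alpha> \<beta> xP yP xQ yQ c i j = pick c
     (pick i (pick j 0 \<alpha> (a * yP) 0) (pick j \<alpha> 0 0 (a * xP))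
             (pick j (- (a * yP)) 0 0 yP) (pick j 0 (a * xP) (- yP) 0))
     (pick i (pick j \<alpha> 0 0 (a * xP)) (pick j 0 \<alpha> (a * yP) 0)
             (pick j 0 (- (a * yP)) (- xP) 0) (pick j (a * xP) 0 0 (- xP)))
     (pick i (pick j (a * yQ) 0 0 (- yQ)) (pick j 0 (- (a * yQ)) (- xQ) 0)
             (pick j 0 xQ \<beta> 0) (pick j (- yQ) 0 0 (- \<beta>)))
     (pick i (pick j 0 (- (a * xQ)) yQ 0) (pick j (a * xQ) 0 0 (- xQ))
             (pick j yQ 0 0 \<beta>) (pick j 0 xQ \<beta> 0))"

definition biv :: "4 \<Rightarrow> 4 \<Rightarrow> 4 \<Rightarrow> 4 \<Rightarrow> real" where
  "biv i j a b = (if a = i \<and> b = j then 1 else if a = j \<and> b = i then - 1 else 0)"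

text \<open>\<open>f1\<close>, \<open>f2\<close>, \<open>f3\<close> hold the diagonal part and
  \<open>f4\<close> the dual, magnetic part. The coefficients of \<open>f4\<close> satisfy the first
  Bianchi identity R_1234 + R_1342 + R_1423 = 0. The signs in the \<open>f3\<close> part reflect
  that the first squared length is minus the second. The array is again linear in its
  scalars.\<close>

definition curv :: "real \<Rightarrow> real \<Rightarrow> real \<Rightarrow> real \<Rightarrow> 4 \<Rightarrow> 4 \<Rightarrow> 4 \<Rightarrow> 4 \<Rightarrow> real" where
  "curv f1 f2 f3 f4 a b c d =
     f1 * (biv 1 2 a b * biv 1 2 c d) + f2 * (biv 3 4 a b * biv 3 4 c d)
     + f3 * (biv 2 3 a b * biv 2 3 c d + biv 2 4 a b * biv 2 4 c d
             - biv 1 3 a b * biv 1 3 c d - biv 1 4 a b * biv 1 4 c d)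
     + f4 * (2 * biv 1 2 a b * biv 3 4 c d + 2 * biv 3 4 a b * biv 1 2 c d
             + biv 1 3 a b * biv 2 4 c d + biv 2 4 a b * biv 1 3 c d
             - biv 1 4 a b * biv 2 3 c d - biv 2 3 a b * biv 1 4 c d)"

lemma biv_antisym: "biv i j b a = - biv i j a b" if "i \<noteq> j"
  using that by (auto simp: biv_def)

lemma curv_antisym:
  "curv f1 f2 f3 f4 b a c d = - curv f1 f2 f3 f4 a b c d"
  "curv f1 f2 f3 f4 a b d c = - curv f1 f2 f3 f4 a b c d"
  by (simp_all add: curv_def biv_antisym[of _ _ a b] biv_antisym[of _ _ c d] algebra_simps)

text \<open>Cuts the curvature and torsion checks from sixteen index pairs to six.\<close>

lemma antisym_4_eqI:
  fixes f f' :: "4 \<Rightarrow> 4 \<Rightarrow> real"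
  assumes "\<And>i j. f j i = - f i j" "\<And>i j. f' j i = - f' i j"
    and "f 1 2 = f' 1 2" "f 1 3 = f' 1 3" "f 1 4 = f' 1 4" "f 2 3 = f' 2 3" "f 2 4 = f' 2 4" "f 3 4 = f' 3 4"
  shows "f i j = f' i j"
proof -
  have "f i i = f' i i" for i
    using assms(1,2)[of i i] by simp
  moreover have "f 2 1 = f' 2 1" "f 3 1 = f' 3 1" "f 4 1 = f' 4 1" "f 3 2 = f' 3 2" "f 4 2 = f' 4 2" "f 4 3 = f' 4 3"
    using assms by metis+
  ultimately show ?thesis
    using exhaust_4[of i] exhaust_4[of j] assms(3-) by (elim disjE) simp_all
qed

lemma sum_antisym_4:
  fixes f :: "4 \<Rightarrow> 4 \<Rightarrow> real"
  assumes "\<And>i j. f j i = f i j" "\<And>i. f i i = 0"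
  shows "(\<Sum>i\<in>UNIV. \<Sum>j\<in>UNIV. f i j) = 2 * (f 1 2 + f 1 3 + f 1 4 + f 2 3 + f 2 4 + f 3 4)"
  by (simp add: sum_4 assms(2) assms(1)[of 1 2] assms(1)[of 1 3] assms(1)[of 1 4] assms(1)[of 2 3]
      assms(1)[of 2 4] assms(1)[of 3 4])

text \<open>
  The frame components of the connection and the curvature are polynomials in
  \<open>X = r / \<rho>\<^sup>2\<close> and \<open>Y = a u / \<rho>\<^sup>2\<close> with \<open>u = cos \<theta>\<close>, for which \<open>s = X\<^sup>2 + Y\<^sup>2 = 1 / \<rho>\<^sup>2\<close>, and in
  \<open>Q = \<Delta>\<^sub>r\<close>, \<open>P = \<Delta>\<^sub>\<theta> sin\<^sup>2 \<theta>\<close> and their derivatives in \<open>r\<close> and \<open>u\<close>. The arrays \<open>Cr\<close> and \<open>Cu\<close> are the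
  derivatives of \<open>C\<close>; they follow from \<open>\<partial>\<^sub>r \<zeta> = - \<zeta>\<^sup>2\<close> and \<open>\<partial>\<^sub>u \<zeta> = \<i> a \<zeta>\<^sup>2\<close> for \<open>\<zeta> = X + \<i> Y\<close>.
\<close>

locale knds_alg =
  fixes X Y a Q Qr Qrr P Pu Puu :: real
begin

definition s where "s = X^2 + Y^2"

definition H :: "4 \<Rightarrow> real" where "H i = pick i (- (Q * s)) (Q * s) (P * s) (P * s)"

definition C :: "4 \<Rightarrow> 4 \<Rightarrow> 4 \<Rightarrow> real" where
  "C = conn a (s * (Qr / 2 - X * Q)) (s * (Pu / 2 - a * Y * P)) (X * P * s) (Y * P * s) (X * Q * s) (Y * Q * s)"

definition Cr :: "4 \<Rightarrow> 4 \<Rightarrow> 4 \<Rightarrow> real" where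
  "Cr = conn a (- 2 * X * s * (Qr / 2 - X * Q) + s * (Qrr / 2 - (Y^2 - X^2) * Q - X * Qr))
     (- 2 * X * s * (Pu / 2 - a * Y * P) + s * (2 * a * X * Y * P))
     (s * (Y^2 - 3 * X^2) * P) (- 4 * X * Y * s * P)
     (Qr * X * s + s * (Y^2 - 3 * X^2) * Q) (Qr * Y * s - 4 * X * Y * s * Q)"

definition Cu :: "4 \<Rightarrow> 4 \<Rightarrow> 4 \<Rightarrow> real" where
  "Cu = conn a (- 2 * a * Y * s * (Qr / 2 - X * Q) + s * (2 * a * X * Y * Q))
     (- 2 * a * Y * s * (Pu / 2 - a * Y * P) + s * (Puu / 2 - a^2 * (X^2 - Y^2) * P - a * Y * Pu))
     (Pu * X * s - 4 * a * X * Y * s * P) (Pu * Y * s + a * s * (X^2 - 3 * Y^2) * P)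
     (- 4 * a * X * Y * s * Q) (a * s * (X^2 - 3 * Y^2) * Q)"

text \<open>The frame derivatives: e_2 acts as Q s d/dr and e_3 as P s d/du, while e_1 and e_4 only
  involve t and phi, on which no coefficient depends.\<close>

definition dC :: "4 \<Rightarrow> 4 \<Rightarrow> 4 \<Rightarrow> 4 \<Rightarrow> real" where
  "dC d i j k = pick d 0 (Q * s * Cr i j k) (P * s * Cu i j k) 0"

definition curvC :: "4 \<Rightarrow> 4 \<Rightarrow> 4 \<Rightarrow> 4 \<Rightarrow> real" where
  "curvC i j k l = H i * (dC k i l j - dC l i k j
     + (\<Sum>f\<in>UNIV. C i k f * C f l j - C i l f * C f k j - (C f k l - C f l k) * C i f j))"

definition F1 where "F1 = Q^2 * s^3 * (- 3 * X^2 * a^2 * P + 3 * X^2 * Q - 2 * X * Qr + Y^2 * a^2 * P - Y^2 * Q + Qrr / 2)"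
definition F2 where "F2 = P^2 * s^3 * (X^2 * a^2 * P - X^2 * Q - 3 * Y^2 * a^2 * P + 3 * Y^2 * Q + 2 * Y * a * Pu - Puu / 2)"
definition F3 where "F3 = Q * P * s^3 * (- (X^2 * a^2 * P) + X^2 * Q - X * Qr / 2 + Y^2 * a^2 * P - Y^2 * Q - Y * a * Pu / 2)"
definition F4 where "F4 = Q * P * s^3 * (2 * X * Y * a^2 * P - 2 * X * Y * Q - X * a * Pu / 2 + Y * Qr / 2)"

lemma curvC_antisym: "curvC i j l k = - curvC i j k l"
  unfolding curvC_def by (simp add: sum_subtractf sum_negf algebra_simps)

lemmas curvC_simps = curvC_def H_def dC_def C_def Cr_def Cu_def conn_def sum_4
   curv_def biv_def F1_def F2_def F3_def F4_def s_def

text \<open>Antisymmetry in the last pair is visible in \<open>curvC_def\<close>, but in the first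
  pair it is a consequence of metricity. Hence the first pair runs through all sixteen values
  here.\<close>

lemma curvC_12: "curvC i j 1 2 = curv F1 F2 F3 F4 i j 1 2"
  using exhaust_4[of i] exhaust_4[of j]
  by (elim disjE; simp add: curvC_simps; simp add: ring_nf)

lemma curvC_13: "curvC i j 1 3 = curv F1 F2 F3 F4 i j 1 3"
  using exhaust_4[of i] exhaust_4[of j]
  by (elim disjE; simp add: curvC_simps; simp add: ring_nf)

lemma curvC_14: "curvC i j 1 4 = curv F1 F2 F3 F4 i j 1 4"
  using exhaust_4[of i] exhaust_4[of j]
  by (elim disjE; simp add: curvC_simps; simp add: ring_nf)

lemma curvC_23: "curvC i j 2 3 = curv F1 F2 F3 F4 i j 2 3"
  using exhaust_4[of i] exhaust_4[of j]
  by (elim disjE; simp add: curvC_simps; simp add: ring_nf)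

lemma curvC_24: "curvC i j 2 4 = curv F1 F2 F3 F4 i j 2 4"
  using exhaust_4[of i] exhaust_4[of j]
  by (elim disjE; simp add: curvC_simps; simp add: ring_nf)

lemma curvC_34: "curvC i j 3 4 = curv F1 F2 F3 F4 i j 3 4"
  using exhaust_4[of i] exhaust_4[of j]
  by (elim disjE; simp add: curvC_simps; simp add: ring_nf)

text \<open>No relation between the nine parameters is assumed, so the curvature has this shape for
  arbitrary functions Q of r and P of u; the special choice matters only for the values of the four
  scalars.\<close>

lemma curvC_eq: "curvC i j k l = curv F1 F2 F3 F4 i j k l"
proof (rule antisym_4_eqI[of "curvC i j" "curv F1 F2 F3 F4 i j"])
  show "curvC i j l k = - curvC i j k l" for k l
    by (rule curvC_antisym)
  show "curv F1 F2 F3 F4 i j l k = - curv F1 F2 F3 F4 i j k l" for k l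
    by (rule curv_antisym)
qed (rule curvC_12 curvC_13 curvC_14 curvC_23 curvC_24 curvC_34)+

end

section \<open>The covariant derivative of the curvature\<close>

locale knds_nabla = knds_alg +
  fixes m q \<Lambda> :: real
begin

text \<open>
  Here \<open>W + \<i> V = m \<zeta>\<^sup>3 - q\<^sup>2 \<zeta>\<^sup>2 \<bar>\<zeta>\<bar>\<^sup>2\<close>, which is the Weyl scalar \<open>\<Psi>\<^sub>2\<close> up to sign. The polynomials
  \<open>A1\<close>, \<open>A2\<close>, \<open>B1\<close>, \<open>B2\<close> come from \<open>\<partial>\<^sub>r W = - A1\<close>, \<open>\<partial>\<^sub>u W = - a B2\<close>, \<open>\<partial>\<^sub>r V = - B1\<close>, \<open>\<partial>\<^sub>u V = a A2\<close>.
\<close>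

definition W where "W = m * (X^3 - 3 * X * Y^2) - q^2 * s * (X^2 - Y^2)"
definition V where "V = m * (3 * X^2 * Y - Y^3) - 2 * q^2 * s * X * Y"

definition A1 where "A1 = 3 * m * (X^4 - 6 * X^2 * Y^2 + Y^4) - 4 * q^2 * s * X * (X^2 - 2 * Y^2)"
definition A2 where "A2 = 3 * m * (X^4 - 6 * X^2 * Y^2 + Y^4) - 2 * q^2 * s * X * (X^2 - 5 * Y^2)"
text \<open>\<open>A3\<close> is 2 A1 - 4 q^2 X s^2, which is minus the r-derivative of
  \<open>k1\<close>. Likewise \<open>B3\<close> is 2 B2 + 4 q^2 Y s^2, and the u-derivative of
  \<open>k2\<close> is - a B3.\<close>

definition A3 where "A3 = 6 * m * (X^4 - 6 * X^2 * Y^2 + Y^4) - 12 * q^2 * s * X * (X^2 - Y^2)"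
definition B1 where "B1 = 12 * m * X * Y * (X^2 - Y^2) - 2 * q^2 * s * Y * (5 * X^2 - Y^2)"
definition B2 where "B2 = 12 * m * X * Y * (X^2 - Y^2) - 4 * q^2 * s * Y * (2 * X^2 - Y^2)"
definition B3 where "B3 = 24 * m * X * Y * (X^2 - Y^2) - 12 * q^2 * s * Y * (X^2 - Y^2)"

text \<open>Sectional curvatures: \<open>k1\<close> of the plane of e_1 and e_2, \<open>k2\<close>
  of that of e_3 and e_4, \<open>k3\<close> of the four mixed planes. Summing over the planes
  through one frame vector gives the Ricci eigenvalues \<Lambda> - q^2 s^2 for e_1, e_2 and
  \<Lambda> + q^2 s^2 for e_3, e_4, as for an Einstein-Maxwell field; the Weyl part \<open>W\<close>
  cancels.\<close>

definition k1 where "k1 = \<Lambda> / 3 + 2 * W - q^2 * s^2"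
definition k2 where "k2 = \<Lambda> / 3 + 2 * W + q^2 * s^2"
definition k3 where "k3 = \<Lambda> / 3 - W"

definition Rm :: "4 \<Rightarrow> 4 \<Rightarrow> 4 \<Rightarrow> 4 \<Rightarrow> real" where
  "Rm = curv (- (Q^2 * s^2 * k1)) (P^2 * s^2 * k2) (Q * P * s^2 * k3) (Q * P * s^2 * V)"

definition Rr :: "4 \<Rightarrow> 4 \<Rightarrow> 4 \<Rightarrow> 4 \<Rightarrow> real" where
  "Rr = curv
     (- ((2 * Q * Qr - 4 * X * Q^2) * s^2 * k1 + Q^2 * s^2 * (4 * q^2 * X * s^2 - 2 * A1)))
     (P^2 * s^2 * (- 4 * X * k2 - 4 * q^2 * X * s^2 - 2 * A1))
     (P * s^2 * ((Qr - 4 * X * Q) * k3 + Q * A1))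
     (P * s^2 * ((Qr - 4 * X * Q) * V - Q * B1))"

definition Ru :: "4 \<Rightarrow> 4 \<Rightarrow> 4 \<Rightarrow> 4 \<Rightarrow> real" where
  "Ru = curv
     (- (Q^2 * s^2 * (- 4 * a * Y * k1 + 4 * a * q^2 * Y * s^2 - 2 * a * B2)))
     ((2 * P * Pu - 4 * a * Y * P^2) * s^2 * k2 - P^2 * s^2 * (4 * a * q^2 * Y * s^2 + 2 * a * B2))
     (Q * s^2 * ((Pu - 4 * a * Y * P) * k3 + P * a * B2))
     (Q * s^2 * ((Pu - 4 * a * Y * P) * V + P * a * A2))"

definition nabR :: "4 \<Rightarrow> 4 \<Rightarrow> 4 \<Rightarrow> 4 \<Rightarrow> 4 \<Rightarrow> real" where
  "nabR f i j k l = pick f 0 (Q * s * Rr i j k l) (P * s * Ru i j k l) 0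
     - (\<Sum>p\<in>UNIV. C p f i * Rm p j k l) - (\<Sum>p\<in>UNIV. C p f j * Rm i p k l)
     - (\<Sum>p\<in>UNIV. C p f k * Rm i j p l) - (\<Sum>p\<in>UNIV. C p f l * Rm i j k p)"

lemma Rm_antisym: "Rm j i k l = - Rm i j k l" "Rm i j l k = - Rm i j k l"
  unfolding Rm_def by (rule curv_antisym)+

lemma dRm_antisym:
  "Rr j i k l = - Rr i j k l" "Rr i j l k = - Rr i j k l"
  "Ru j i k l = - Ru i j k l" "Ru i j l k = - Ru i j k l"
  unfolding Rr_def Ru_def by (rule curv_antisym)+

lemma pick_neg: "pick f 0 (- x) (- y) 0 = - pick f 0 x y (0::real)"
  by (simp add: pick_def)

lemma nabR_antisym: "nabR f j i k l = - nabR f i j k l" "nabR f i j l k = - nabR f i j k l"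
  unfolding nabR_def
    Rm_antisym(1)[of j] Rm_antisym(1)[of _ i] Rm_antisym(2)[of _ _ l] Rm_antisym(2)[of _ _ _ k]
    dRm_antisym(1)[of j] dRm_antisym(3)[of j] dRm_antisym(2)[of _ _ l] dRm_antisym(4)[of _ _ l]
  by (simp_all add: pick_neg sum_negf)

lemma curv_sym: "curv f1 f2 f3 f4 k l i j = curv f1 f2 f3 f4 i j k l"
  by (simp add: curv_def algebra_simps)

lemma Rm_sym: "Rm k l i j = Rm i j k l" and dRm_sym: "Rr k l i j = Rr i j k l" "Ru k l i j = Ru i j k l"
  unfolding Rm_def Rr_def Ru_def by (rule curv_sym)+

lemma nabR_sym: "nabR f k l i j = nabR f i j k l"
  unfolding nabR_def dRm_sym[of k l i j] Rm_sym[of _ l i j] Rm_sym[of k _ i j] Rm_sym[of k l _ j]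
    Rm_sym[of k l i _]
  by simp

lemmas nab_simps = nabR_def Rm_def Rr_def Ru_def C_def conn_def sum_4 curv_def biv_def

lemmas nab_polys = k1_def k2_def k3_def W_def V_def A1_def A2_def A3_def B1_def B2_def B3_def s_def

text \<open>By the symmetries, 21 components per direction determine the others. \<open>Qr\<close>,
  \<open>Pu\<close> and \<Lambda> are absent from all results: the prefactors
  \<open>Q^2 * s^2\<close>, \<open>P^2 * s^2\<close>, \<open>Q * P * s^2\<close> are products of
  squared lengths up to sign, so metricity cancels their derivatives. In directions 1 and 4 only
  connection terms contribute.\<close>

lemma nabR_1:
  "nabR 1 1 2 1 2 = 0"
  "nabR 1 1 2 1 3 = 0"
  "nabR 1 1 2 1 4 = a * Q^2 * P * s^3 * A1"
  "nabR 1 1 2 2 3 = - (a * Q^2 * P * s^3 * B1)"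
  "nabR 1 1 2 2 4 = 0"
  "nabR 1 1 2 3 4 = 0"
  "nabR 1 1 3 1 3 = 0"
  "nabR 1 1 3 1 4 = 0"
  "nabR 1 1 3 2 3 = 0"
  "nabR 1 1 3 2 4 = 0"
  "nabR 1 1 3 3 4 = 0"
  "nabR 1 1 4 1 4 = 0"
  "nabR 1 1 4 2 3 = 0"
  "nabR 1 1 4 2 4 = 0"
  "nabR 1 1 4 3 4 = - (a * Q * P^2 * s^3 * B2)"
  "nabR 1 2 3 2 3 = 0"
  "nabR 1 2 3 2 4 = 0"
  "nabR 1 2 3 3 4 = - (a * Q * P^2 * s^3 * A2)"
  "nabR 1 2 4 2 4 = 0"
  "nabR 1 2 4 3 4 = 0"
  "nabR 1 3 4 3 4 = 0"
  by (simp add: nab_simps; simp add: nab_polys; simp add: ring_nf power4_eq_xxxx)+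

lemma nabR_2:
  "nabR 2 1 2 1 2 = Q^3 * s^3 * A3"
  "nabR 2 1 2 1 3 = a * Q^2 * P * s^3 * B1"
  "nabR 2 1 2 1 4 = 0"
  "nabR 2 1 2 2 3 = 0"
  "nabR 2 1 2 2 4 = - (a * Q^2 * P * s^3 * A1)"
  "nabR 2 1 2 3 4 = - (2 * Q^2 * P * s^3 * B1)"
  "nabR 2 1 3 1 3 = - (Q^2 * P * s^3 * A1)"
  "nabR 2 1 3 1 4 = 0"
  "nabR 2 1 3 2 3 = 0"
  "nabR 2 1 3 2 4 = - (Q^2 * P * s^3 * B1)"
  "nabR 2 1 3 3 4 = a * Q * P^2 * s^3 * A2"
  "nabR 2 1 4 1 4 = - (Q^2 * P * s^3 * A1)"
  "nabR 2 1 4 2 3 = Q^2 * P * s^3 * B1"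
  "nabR 2 1 4 2 4 = 0"
  "nabR 2 1 4 3 4 = 0"
  "nabR 2 2 3 2 3 = Q^2 * P * s^3 * A1"
  "nabR 2 2 3 2 4 = 0"
  "nabR 2 2 3 3 4 = 0"
  "nabR 2 2 4 2 4 = Q^2 * P * s^3 * A1"
  "nabR 2 2 4 3 4 = a * Q * P^2 * s^3 * B2"
  "nabR 2 3 4 3 4 = - (2 * Q * P^2 * s^3 * A2)"
  by (simp add: nab_simps; simp add: nab_polys; simp add: ring_nf power4_eq_xxxx)+

lemma nabR_3:
  "nabR 3 1 2 1 2 = 2 * a * Q^2 * P * s^3 * B1"
  "nabR 3 1 2 1 3 = - (Q^2 * P * s^3 * A1)"
  "nabR 3 1 2 1 4 = 0"
  "nabR 3 1 2 2 3 = 0"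
  "nabR 3 1 2 2 4 = - (Q^2 * P * s^3 * B1)"
  "nabR 3 1 2 3 4 = 2 * a * Q * P^2 * s^3 * A2"
  "nabR 3 1 3 1 3 = - (a * Q * P^2 * s^3 * B2)"
  "nabR 3 1 3 1 4 = 0"
  "nabR 3 1 3 2 3 = 0"
  "nabR 3 1 3 2 4 = a * Q * P^2 * s^3 * A2"
  "nabR 3 1 3 3 4 = Q * P^2 * s^3 * B2"
  "nabR 3 1 4 1 4 = - (a * Q * P^2 * s^3 * B2)"
  "nabR 3 1 4 2 3 = - (a * Q * P^2 * s^3 * A2)"
  "nabR 3 1 4 2 4 = 0"
  "nabR 3 1 4 3 4 = 0"
  "nabR 3 2 3 2 3 = a * Q * P^2 * s^3 * B2"
  "nabR 3 2 3 2 4 = 0"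
  "nabR 3 2 3 3 4 = 0"
  "nabR 3 2 4 2 4 = a * Q * P^2 * s^3 * B2"
  "nabR 3 2 4 3 4 = - (Q * P^2 * s^3 * A2)"
  "nabR 3 3 4 3 4 = - (a * P^3 * s^3 * B3)"
  by (simp add: nab_simps; simp add: nab_polys; simp add: ring_nf power4_eq_xxxx)+

lemma nabR_4:
  "nabR 4 1 2 1 2 = 0"
  "nabR 4 1 2 1 3 = 0"
  "nabR 4 1 2 1 4 = - (Q^2 * P * s^3 * A1)"
  "nabR 4 1 2 2 3 = Q^2 * P * s^3 * B1"
  "nabR 4 1 2 2 4 = 0"
  "nabR 4 1 2 3 4 = 0"
  "nabR 4 1 3 1 3 = 0"
  "nabR 4 1 3 1 4 = 0"
  "nabR 4 1 3 2 3 = 0"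
  "nabR 4 1 3 2 4 = 0"
  "nabR 4 1 3 3 4 = 0"
  "nabR 4 1 4 1 4 = 0"
  "nabR 4 1 4 2 3 = 0"
  "nabR 4 1 4 2 4 = 0"
  "nabR 4 1 4 3 4 = Q * P^2 * s^3 * B2"
  "nabR 4 2 3 2 3 = 0"
  "nabR 4 2 3 2 4 = 0"
  "nabR 4 2 3 3 4 = Q * P^2 * s^3 * A2"
  "nabR 4 2 4 2 4 = 0"
  "nabR 4 2 4 3 4 = 0"
  "nabR 4 3 4 3 4 = 0"
  by (simp add: nab_simps; simp add: nab_polys; simp add: ring_nf power4_eq_xxxx)+

section \<open>The squared norm, one derivative direction at a time\<close>

definition norm_nabR :: "4 \<Rightarrow> real" where
  "norm_nabR f = (\<Sum>i\<in>UNIV. \<Sum>j\<in>UNIV. \<Sum>k\<in>UNIV. \<Sum>l\<in>UNIV.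
     (nabR f i j k l)^2 / (H f * H i * H j * H k * H l))"

lemma norm_nabR_eq:
  "norm_nabR f = 4 * (\<Sum>(i, j)\<in>{(1, 2), (1, 3), (1, 4), (2, 3), (2, 4), (3, 4)}.
     \<Sum>(k, l)\<in>{(1, 2), (1, 3), (1, 4), (2, 3), (2, 4), (3, 4)}.
       (nabR f i j k l)^2 / (H f * H i * H j * H k * H l))"
proof -
  define S where "S i j = (\<Sum>k\<in>UNIV. \<Sum>l\<in>UNIV. (nabR f i j k l)^2 / (H f * H i * H j * H k * H l))" for i j
  have S: "S i j = 2 * (\<Sum>(k, l)\<in>{(1, 2), (1, 3), (1, 4), (2, 3), (2, 4), (3, 4)}.
       (nabR f i j k l)^2 / (H f * H i * H j * H k * H l))" for i j
  proof -
    have "nabR f i j k k = 0" for k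
      using nabR_antisym(2)[of f i j k k] by simp
    moreover have "(nabR f i j l k)^2 = (nabR f i j k l)^2" for k l
      by (subst nabR_antisym(2)) simp
    ultimately show ?thesis
      unfolding S_def by (subst sum_antisym_4) (simp_all add: mult_ac add_ac)
  qed
  have "nabR f i i k l = 0" for i k l
    using nabR_antisym(1)[of f i i k l] by simp
  then have "S i i = 0" for i
    by (simp add: S_def)
  moreover have "S j i = S i j" for i j
    unfolding S_def by (subst nabR_antisym(1)) (simp add: mult_ac)
  ultimately have "norm_nabR f = 2 * (S 1 2 + S 1 3 + S 1 4 + S 2 3 + S 2 4 + S 3 4)"
    unfolding norm_nabR_def S_def[symmetric] by (subst sum_antisym_4) simp_all
  then show ?thesis
    unfolding S by (simp add: add_ac)
qed

text \<open>The sum runs over ordered pairs of bivectors; these instances direct the pair symmetry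
  towards the components computed above.\<close>

lemmas nabR_swap =
  nabR_sym[of _ 1 3 1 2]
  nabR_sym[of _ 1 4 1 2]
  nabR_sym[of _ 1 4 1 3]
  nabR_sym[of _ 2 3 1 2]
  nabR_sym[of _ 2 3 1 3]
  nabR_sym[of _ 2 3 1 4]
  nabR_sym[of _ 2 4 1 2]
  nabR_sym[of _ 2 4 1 3]
  nabR_sym[of _ 2 4 1 4]
  nabR_sym[of _ 2 4 2 3]
  nabR_sym[of _ 3 4 1 2]
  nabR_sym[of _ 3 4 1 3]
  nabR_sym[of _ 3 4 1 4]
  nabR_sym[of _ 3 4 2 3]
  nabR_sym[of _ 3 4 2 4]

text \<open>A weight is a monomial in Q, P, s whose sign is -1 to the number of indices equal to 1,
  since \<open>H 1\<close> is the only length written with a minus; so some squares enter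
  negatively. A pair of distinct bivectors counts 8, the 4 of \<open>norm_nabR_eq\<close> for both
  orders, and a pair of equal ones counts 4.\<close>

lemma norm_nabR_1:
  assumes "Q \<noteq> 0" "P \<noteq> 0" "s \<noteq> 0"
  shows "norm_nabR 1 = s * (a^2 * P * (8 * B1^2 - 8 * A1^2 + 8 * B2^2 - 8 * A2^2))"
  using assms
  by (simp add: norm_nabR_eq nabR_swap nabR_1 H_def; simp add: field_simps; simp add: ring_nf power_numeral_reduce)

lemma norm_nabR_2:
  assumes "Q \<noteq> 0" "P \<noteq> 0" "s \<noteq> 0"
  shows "norm_nabR 2 = s * (Q * (4 * A3^2 + 16 * A1^2 + 16 * A2^2 - 48 * B1^2) + a^2 * P * (8 * B1^2 - 8 * A1^2 - 8 * A2^2 + 8 * B2^2))"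
  using assms
  by (simp add: norm_nabR_eq nabR_swap nabR_2 H_def; simp add: field_simps; simp add: ring_nf power_numeral_reduce)

lemma norm_nabR_3:
  assumes "Q \<noteq> 0" "P \<noteq> 0" "s \<noteq> 0"
  shows "norm_nabR 3 = s * (Q * (8 * A1^2 - 8 * B1^2 - 8 * B2^2 + 8 * A2^2) + a^2 * P * (16 * B1^2 - 48 * A2^2 + 16 * B2^2 + 4 * B3^2))"
  using assms
  by (simp add: norm_nabR_eq nabR_swap nabR_3 H_def; simp add: field_simps; simp add: ring_nf power_numeral_reduce)

lemma norm_nabR_4:
  assumes "Q \<noteq> 0" "P \<noteq> 0" "s \<noteq> 0"
  shows "norm_nabR 4 = s * (Q * (8 * A1^2 - 8 * B1^2 - 8 * B2^2 + 8 * A2^2))"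
  using assms
  by (simp add: norm_nabR_eq nabR_swap nabR_4 H_def; simp add: field_simps; simp add: ring_nf power_numeral_reduce)

end

section \<open>The Kerr-Newman-(anti-)de Sitter frame\<close>

lemma has_partial_chart:
  fixes x :: "real ^ 4"
  assumes "((\<lambda>r. F r (x $ 3)) has_real_derivative Fr) (at (x $ 2))"
    and "((\<lambda>\<theta>. F (x $ 2) \<theta>) has_real_derivative F\<theta>) (at (x $ 3))"
  shows "has_partial k (\<lambda>y. F (y $ 2) (y $ 3)) (pick k 0 Fr F\<theta> 0) x"
proof -
  have 2: "((\<lambda>h. F (x $ 2 + h) (x $ 3)) has_real_derivative Fr) (at 0)"
    using assms(1) DERIV_shift[of "\<lambda>r. F r (x $ 3)" Fr 0 "x $ 2"] by (simp only: add_0 add.commute[of "x $ 2"])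
  have 3: "((\<lambda>h. F (x $ 2) (x $ 3 + h)) has_real_derivative F\<theta>) (at 0)"
    using assms(2) DERIV_shift[of "\<lambda>\<theta>. F (x $ 2) \<theta>" F\<theta> 0 "x $ 3"] by (simp only: add_0 add.commute[of "x $ 3"])
  show ?thesis
    using exhaust_4[of k] 2 3
    by (elim disjE) (simp_all add: has_partial_def axis_def)
qed

lemma has_partial_chart_cos:
  fixes x :: "real ^ 4"
  assumes "((\<lambda>r. F r (cos (x $ 3))) has_real_derivative Fr) (at (x $ 2))"
    and "((\<lambda>u. F (x $ 2) u) has_real_derivative Fu) (at (cos (x $ 3)))"
  shows "has_partial k (\<lambda>y. F (y $ 2) (cos (y $ 3))) (pick k 0 Fr (- sin (x $ 3) * Fu) 0) x"
proof (rule has_partial_chart[of "\<lambda>r \<theta>. F r (cos \<theta>)"])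
  show "((\<lambda>\<theta>. F (x $ 2) (cos \<theta>)) has_real_derivative - sin (x $ 3) * Fu) (at (x $ 3))"
    using DERIV_chain2[OF assms(2) DERIV_cos] by (simp add: mult.commute)
qed (rule assms(1))

lemma DERIV_pick:
  assumes "(p has_real_derivative p') (at z within A)" "(q has_real_derivative q') (at z within A)"
    "(s has_real_derivative s') (at z within A)" "(t has_real_derivative t') (at z within A)"
  shows "((\<lambda>x. pick i (p x) (q x) (s x) (t x)) has_real_derivative pick i p' q' s' t') (at z within A)"
  using assms by (simp add: pick_def)

lemma DERIV_conn:
  assumes "(\<alpha> has_real_derivative \<alpha>') (at z within A)" "(\<beta> has_real_derivative \<beta>') (at z within A)"
    "(xP has_real_derivative xP') (at z within A)" "(yP has_real_derivative yP') (at z within A)"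
    "(xQ has_real_derivative xQ') (at z within A)" "(yQ has_real_derivative yQ') (at z within A)"
  shows "((\<lambda>x. conn a (\<alpha> x) (\<beta> x) (xP x) (yP x) (xQ x) (yQ x) c i j)
    has_real_derivative conn a \<alpha>' \<beta>' xP' yP' xQ' yQ' c i j) (at z within A)"
  unfolding conn_def
  by (intro DERIV_pick DERIV_const DERIV_minus DERIV_cmult assms)

lemma DERIV_curv:
  assumes "(f1 has_real_derivative f1') (at z within A)" "(f2 has_real_derivative f2') (at z within A)"
    "(f3 has_real_derivative f3') (at z within A)" "(f4 has_real_derivative f4') (at z within A)"
  shows "((\<lambda>x. curv (f1 x) (f2 x) (f3 x) (f4 x) a b c d) has_real_derivative curv f1' f2' f3' f4' a b c d) (at z within A)"
  unfolding curv_def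
  by (intro DERIV_add DERIV_cmult_right assms)

lemma pdiff_pick:
  "pdiff k p x \<Longrightarrow> pdiff k q x \<Longrightarrow> pdiff k s x \<Longrightarrow> pdiff k t x
    \<Longrightarrow> pdiff k (\<lambda>y. pick i (p y) (q y) (s y) (t y)) x"
  using exhaust_4[of i] by (elim disjE) simp_all

locale knds =
  fixes a m q \<Lambda> :: real
  assumes Xi_nonzero: "Xi a \<Lambda> \<noteq> 0"
begin

definition Sg where "Sg r u = r^2 + a^2 * u^2"
definition X where "X r u = r / Sg r u"
definition Y where "Y r u = a * u / Sg r u"
definition Q where "Q r = (1 - \<Lambda> / 3 * r^2) * (r^2 + a^2) - 2 * m * r + q^2"
definition Q1 where "Q1 r = 2 * r * (1 - \<Lambda> / 3 * (2 * r^2 + a^2)) - 2 * m"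
definition Q2 where "Q2 r = 2 - 4 * \<Lambda> * r^2 - 2 * a^2 * \<Lambda> / 3"
definition P where "P u = (1 - u^2) * (1 + a^2 * \<Lambda> / 3 * u^2)"
definition P1 where "P1 u = 2 * u * (a^2 * \<Lambda> / 3 * (1 - 2 * u^2) - 1)"
definition P2 where "P2 u = 2 * a^2 * \<Lambda> / 3 - 4 * a^2 * \<Lambda> * u^2 - 2"

text \<open>The point (r, u) remains a parameter, so the constants of the algebraic locale become
  functions of r and u that can be differentiated.\<close>

sublocale fr: knds_nabla "X r u" "Y r u" a "Q r" "Q1 r" "Q2 r" "P u" "P1 u" "P2 u" m q \<Lambda>
  for r u .

lemma s_eq: "Sg r u \<noteq> 0 \<Longrightarrow> fr.s r u = 1 / Sg r u"
  unfolding fr.s_def unfolding X_def Y_def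
  by (simp add: field_simps power2_eq_square) (simp add: Sg_def power2_eq_square algebra_simps)

lemma DERIV_Q: "(Q has_real_derivative Q1 r) (at r)"
  unfolding Q_def[abs_def] Q1_def by (rule derivative_eq_intros refl)+ (simp add: algebra_simps power2_eq_square)

lemma DERIV_Q1: "(Q1 has_real_derivative Q2 r) (at r)"
  unfolding Q1_def[abs_def] Q2_def by (rule derivative_eq_intros refl)+ (simp add: algebra_simps power2_eq_square)

lemma DERIV_P: "(P has_real_derivative P1 u) (at u)"
  unfolding P_def[abs_def] P1_def by (rule derivative_eq_intros refl)+ (simp add: ring_nf)

lemma DERIV_P1: "(P1 has_real_derivative P2 u) (at u)"
  unfolding P1_def[abs_def] P2_def by (rule derivative_eq_intros refl)+ (simp add: ring_nf)

lemma DERIV_Sg_r: "((\<lambda>r. Sg r u) has_real_derivative 2 * r) (at r)"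
  unfolding Sg_def by (rule derivative_eq_intros refl)+ simp

lemma DERIV_Sg_u: "((\<lambda>u. Sg r u) has_real_derivative 2 * a^2 * u) (at u)"
  unfolding Sg_def by (rule derivative_eq_intros refl)+ simp

lemma DERIV_X_r: "Sg r u \<noteq> 0 \<Longrightarrow> ((\<lambda>r. X r u) has_real_derivative (Y r u)^2 - (X r u)^2) (at r)"
  unfolding X_def Y_def
  by (rule DERIV_cong[OF DERIV_divide[OF DERIV_ident DERIV_Sg_r]], assumption)
    (simp add: field_simps power2_eq_square; simp add: Sg_def ring_nf)

lemma DERIV_X_u: "Sg r u \<noteq> 0 \<Longrightarrow> ((\<lambda>u. X r u) has_real_derivative - 2 * a * X r u * Y r u) (at u)"
  unfolding X_def Y_def
  by (rule DERIV_cong[OF DERIV_divide[OF DERIV_const DERIV_Sg_u]], assumption)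
    (simp add: field_simps power2_eq_square; simp add: Sg_def ring_nf)

lemma DERIV_Y_r: "Sg r u \<noteq> 0 \<Longrightarrow> ((\<lambda>r. Y r u) has_real_derivative - 2 * X r u * Y r u) (at r)"
  unfolding X_def Y_def
  by (rule DERIV_cong[OF DERIV_divide[OF DERIV_const DERIV_Sg_r]], assumption)
    (simp add: field_simps power2_eq_square; simp add: Sg_def ring_nf)

lemma DERIV_Y_u: "Sg r u \<noteq> 0 \<Longrightarrow> ((\<lambda>u. Y r u) has_real_derivative a * ((X r u)^2 - (Y r u)^2)) (at u)"
  unfolding X_def Y_def
  by (rule DERIV_cong[OF DERIV_divide[OF DERIV_cmult_Id DERIV_Sg_u]], assumption)
    (simp add: field_simps power2_eq_square; simp add: Sg_def ring_nf)

lemma DERIV_s_r: "Sg r u \<noteq> 0 \<Longrightarrow> ((\<lambda>r. fr.s r u) has_real_derivative - 2 * X r u * fr.s r u) (at r)"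
  unfolding fr.s_def
  by (rule DERIV_cong, (rule derivative_intros DERIV_X_r DERIV_Y_r | assumption)+)
     (simp add: algebra_simps power2_eq_square)

lemma DERIV_s_u: "Sg r u \<noteq> 0 \<Longrightarrow> ((\<lambda>u. fr.s r u) has_real_derivative - 2 * a * Y r u * fr.s r u) (at u)"
  unfolding fr.s_def
  by (rule DERIV_cong, (rule derivative_intros DERIV_X_u DERIV_Y_u | assumption)+)
     (simp add: algebra_simps power2_eq_square)

lemmas D_r = DERIV_X_r DERIV_Y_r DERIV_s_r DERIV_Q DERIV_Q1
lemmas D_u = DERIV_X_u DERIV_Y_u DERIV_s_u DERIV_P DERIV_P1

lemma DERIV_C_r: "Sg r u \<noteq> 0 \<Longrightarrow> ((\<lambda>r. fr.C r u c i j) has_real_derivative fr.Cr r u c i j) (at r)"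
  unfolding fr.C_def fr.Cr_def
  by (rule DERIV_conn; (rule DERIV_cong, (rule D_r DERIV_cdivide derivative_intros | assumption)+, simp add: ring_nf))

lemma DERIV_C_u: "Sg r u \<noteq> 0 \<Longrightarrow> ((\<lambda>u. fr.C r u c i j) has_real_derivative fr.Cu r u c i j) (at u)"
  unfolding fr.C_def fr.Cu_def
  by (rule DERIV_conn; (rule DERIV_cong, (rule D_u DERIV_cdivide derivative_intros | assumption)+, simp add: ring_nf))

lemma DERIV_R_r:
  assumes "Sg r u \<noteq> 0"
  shows "((\<lambda>r. fr.Rm r u i j k l) has_real_derivative fr.Rr r u i j k l) (at r)"
proof -
  have W: "((\<lambda>r. fr.W r u) has_real_derivative - fr.A1 r u) (at r)"
    unfolding fr.W_def fr.A1_def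
    by (rule DERIV_cong, (rule D_r derivative_intros assms)+)
      (simp add: fr.s_def ring_nf power4_eq_xxxx)
  have V: "((\<lambda>r. fr.V r u) has_real_derivative - fr.B1 r u) (at r)"
    unfolding fr.V_def fr.B1_def
    by (rule DERIV_cong, (rule D_r derivative_intros assms)+)
      (simp add: fr.s_def ring_nf power4_eq_xxxx)
  have k1: "((\<lambda>r. fr.k1 r u) has_real_derivative 4 * q^2 * X r u * (fr.s r u)^2 - 2 * fr.A1 r u) (at r)"
    unfolding fr.k1_def
    by (rule DERIV_cong, (rule W D_r DERIV_cdivide derivative_intros assms)+) (simp add: ring_nf)
  have k2: "((\<lambda>r. fr.k2 r u) has_real_derivative - 4 * q^2 * X r u * (fr.s r u)^2 - 2 * fr.A1 r u) (at r)"
    unfolding fr.k2_def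
    by (rule DERIV_cong, (rule W D_r DERIV_cdivide derivative_intros assms)+) (simp add: ring_nf)
  have k3: "((\<lambda>r. fr.k3 r u) has_real_derivative fr.A1 r u) (at r)"
    unfolding fr.k3_def
    by (rule DERIV_cong, (rule W D_r DERIV_cdivide derivative_intros assms)+) (simp add: ring_nf)
  note k = k1 k2 k3
  show ?thesis
    unfolding fr.Rm_def fr.Rr_def
    by (rule DERIV_curv; (rule DERIV_cong, (rule k V D_r derivative_intros assms)+, simp add: ring_nf))
qed

lemma DERIV_R_u:
  assumes "Sg r u \<noteq> 0"
  shows "((\<lambda>u. fr.Rm r u i j k l) has_real_derivative fr.Ru r u i j k l) (at u)"
proof -
  have W: "((\<lambda>u. fr.W r u) has_real_derivative - a * fr.B2 r u) (at u)"
    unfolding fr.W_def fr.B2_def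
    by (rule DERIV_cong, (rule D_u derivative_intros assms)+)
      (simp add: fr.s_def ring_nf power4_eq_xxxx)
  have V: "((\<lambda>u. fr.V r u) has_real_derivative a * fr.A2 r u) (at u)"
    unfolding fr.V_def fr.A2_def
    by (rule DERIV_cong, (rule D_u derivative_intros assms)+)
      (simp add: fr.s_def ring_nf power4_eq_xxxx)
  have k1: "((\<lambda>u. fr.k1 r u) has_real_derivative 4 * a * q^2 * Y r u * (fr.s r u)^2 - 2 * a * fr.B2 r u) (at u)"
    unfolding fr.k1_def
    by (rule DERIV_cong, (rule W D_u DERIV_cdivide derivative_intros assms)+) (simp add: ring_nf)
  have k2: "((\<lambda>u. fr.k2 r u) has_real_derivative - 4 * a * q^2 * Y r u * (fr.s r u)^2 - 2 * a * fr.B2 r u) (at u)"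
    unfolding fr.k2_def
    by (rule DERIV_cong, (rule W D_u DERIV_cdivide derivative_intros assms)+) (simp add: ring_nf)
  have k3: "((\<lambda>u. fr.k3 r u) has_real_derivative a * fr.B2 r u) (at u)"
    unfolding fr.k3_def
    by (rule DERIV_cong, (rule W D_u DERIV_cdivide derivative_intros assms)+) (simp add: ring_nf)
  note k = k1 k2 k3
  show ?thesis
    unfolding fr.Rm_def fr.Ru_def
    by (rule DERIV_curv; (rule DERIV_cong, (rule k V D_u derivative_intros assms)+, simp add: ring_nf))
qed

section \<open>Explicit curvature scalars\<close>

lemma W_eq: "Sg r u \<noteq> 0 \<Longrightarrow> fr.W r u = (m * (r^3 - 3 * a^2 * u^2 * r) - q^2 * (r^2 - a^2 * u^2)) / (Sg r u)^3"
  unfolding fr.W_def s_eq unfolding X_def Y_def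
  by (simp add: divide_simps) (simp add: ring_nf power_numeral_reduce)

lemma V_eq: "Sg r u \<noteq> 0 \<Longrightarrow> fr.V r u = (m * (3 * r^2 * a * u - a^3 * u^3) - 2 * q^2 * r * a * u) / (Sg r u)^3"
  unfolding fr.V_def s_eq unfolding X_def Y_def
  by (simp add: divide_simps) (simp add: ring_nf power_numeral_reduce)

text \<open>The Einstein-Maxwell equations enter here: they are the identities that eliminate \<open>Q\<close>, \<open>P\<close> and
  their derivatives from the curvature.\<close>

lemma field_equations:
  assumes "Sg r u \<noteq> 0"
  shows "fr.F1 r u = - ((Q r)^2 * (fr.s r u)^2 * fr.k1 r u)"
    and "fr.F2 r u = (P u)^2 * (fr.s r u)^2 * fr.k2 r u"
    and "fr.F3 r u = Q r * P u * (fr.s r u)^2 * fr.k3 r u"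
    and "fr.F4 r u = Q r * P u * (fr.s r u)^2 * fr.V r u"
proof -
  define \<sigma> where "\<sigma> = Sg r u"
  have \<sigma>: "\<sigma> \<noteq> 0" "fr.s r u = 1 / \<sigma>" "X r u = r / \<sigma>" "Y r u
      = a * u / \<sigma>"
    using assms s_eq[OF assms] unfolding \<sigma>_def by (simp, simp, simp add: X_def, simp add: Y_def)
  note WV = W_eq[OF assms, folded \<sigma>_def] V_eq[OF assms, folded \<sigma>_def]
  note poly = \<sigma>_def Sg_def Q_def Q1_def Q2_def P_def P1_def P2_def
  \<comment> \<open>Of the three factors s in \<open>F1\<close>, two remain in the claim; the third
    brings the bracket over \<sigma>^3, the denominator of \<open>W\<close>. What remains is an
    identity of numerators, in which the explicit Q and P are inserted. The other three scalars are
    treated alike.\<close>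
  have "fr.s r u * (- 3 * (X r u)^2 * a^2 * P u + 3 * (X r u)^2 * Q r - 2 * (X r u) * Q1 r
      + (Y r u)^2 * a^2 * P u - (Y r u)^2 * Q r + Q2 r / 2)
      = (- 3 * r^2 * a^2 * P u + 3 * r^2 * Q r - 2 * r * \<sigma> * Q1 r + a^2 * u^2 * a^2 * P u
      - a^2 * u^2 * Q r + \<sigma>^2 * Q2 r / 2) / \<sigma>^3"
    unfolding \<sigma>(2) unfolding \<sigma>(3,4) using \<sigma>(1)
    by (simp add: divide_simps) (simp add: ring_nf power_numeral_reduce)
  also have "- 3 * r^2 * a^2 * P u + 3 * r^2 * Q r - 2 * r * \<sigma> * Q1 r + a^2 * u^2 * a^2 * P u
      - a^2 * u^2 * Q r + \<sigma>^2 * Q2 r / 2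
      = - (\<Lambda> / 3 * \<sigma>^3 + 2 * (m * (r^3 - 3 * a^2 * u^2 * r) - q^2 * (r^2 - a^2 * u^2))
      - q^2 * \<sigma>)"
    unfolding poly by (simp add: ring_nf power_numeral_reduce)
  also have "(- (\<Lambda> / 3 * \<sigma>^3 + 2 * (m * (r^3 - 3 * a^2 * u^2 * r) - q^2 * (r^2
      - a^2 * u^2)) - q^2 * \<sigma>)) / \<sigma>^3 = - fr.k1 r u"
    unfolding fr.k1_def WV \<sigma>(2) using \<sigma>(1) by (simp add: divide_simps; simp add: ring_nf power_numeral_reduce)
  finally show "fr.F1 r u = - ((Q r)^2 * (fr.s r u)^2 * fr.k1 r u)"
    unfolding fr.F1_def by (simp add: power3_eq_cube power2_eq_square mult.assoc)
  have "fr.s r u * ((X r u)^2 * a^2 * P u - (X r u)^2 * Q r - 3 * (Y r u)^2 * a^2 * P u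
      + 3 * (Y r u)^2 * Q r + 2 * (Y r u) * a * P1 u - P2 u / 2)
      = (r^2 * a^2 * P u - r^2 * Q r - 3 * a^2 * u^2 * a^2 * P u + 3 * a^2 * u^2 * Q r
      + 2 * a^2 * u * \<sigma> * P1 u - \<sigma>^2 * P2 u / 2) / \<sigma>^3"
    unfolding \<sigma>(2) unfolding \<sigma>(3,4) using \<sigma>(1)
    by (simp add: divide_simps) (simp add: ring_nf power_numeral_reduce)
  also have "r^2 * a^2 * P u - r^2 * Q r - 3 * a^2 * u^2 * a^2 * P u + 3 * a^2 * u^2 * Q r
      + 2 * a^2 * u * \<sigma> * P1 u - \<sigma>^2 * P2 u / 2
      = \<Lambda> / 3 * \<sigma>^3 + 2 * (m * (r^3 - 3 * a^2 * u^2 * r) - q^2 * (r^2 - a^2 * u^2))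
      + q^2 * \<sigma>"
    unfolding poly by (simp add: ring_nf power_numeral_reduce)
  also have "(\<Lambda> / 3 * \<sigma>^3 + 2 * (m * (r^3 - 3 * a^2 * u^2 * r) - q^2 * (r^2
      - a^2 * u^2)) + q^2 * \<sigma>) / \<sigma>^3 = fr.k2 r u"
    unfolding fr.k2_def WV \<sigma>(2) using \<sigma>(1) by (simp add: divide_simps; simp add: ring_nf power_numeral_reduce)
  finally show "fr.F2 r u = (P u)^2 * (fr.s r u)^2 * fr.k2 r u"
    unfolding fr.F2_def by (simp add: power3_eq_cube power2_eq_square mult.assoc)
  have "fr.s r u * (- ((X r u)^2 * a^2 * P u) + (X r u)^2 * Q r - (X r u) * Q1 r / 2
      + (Y r u)^2 * a^2 * P u - (Y r u)^2 * Q r - (Y r u) * a * P1 u / 2)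
      = (- (r^2 * a^2 * P u) + r^2 * Q r - r * \<sigma> * Q1 r / 2 + a^2 * u^2 * a^2 * P u
      - a^2 * u^2 * Q r - a^2 * u * \<sigma> * P1 u / 2) / \<sigma>^3"
    unfolding \<sigma>(2) unfolding \<sigma>(3,4) using \<sigma>(1)
    by (simp add: divide_simps) (simp add: ring_nf power_numeral_reduce)
  also have "- (r^2 * a^2 * P u) + r^2 * Q r - r * \<sigma> * Q1 r / 2 + a^2 * u^2 * a^2 * P u
      - a^2 * u^2 * Q r - a^2 * u * \<sigma> * P1 u / 2
      = \<Lambda> / 3 * \<sigma>^3 - (m * (r^3 - 3 * a^2 * u^2 * r) - q^2 * (r^2 - a^2 * u^2))"
    unfolding poly by (simp add: ring_nf power_numeral_reduce)
  also have "(\<Lambda> / 3 * \<sigma>^3 - (m * (r^3 - 3 * a^2 * u^2 * r) - q^2 * (r^2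
      - a^2 * u^2))) / \<sigma>^3 = fr.k3 r u"
    unfolding fr.k3_def WV \<sigma>(2) using \<sigma>(1) by (simp add: divide_simps; simp add: ring_nf power_numeral_reduce)
  finally show "fr.F3 r u = Q r * P u * (fr.s r u)^2 * fr.k3 r u"
    unfolding fr.F3_def by (simp add: power3_eq_cube power2_eq_square mult.assoc)
  have "fr.s r u * (2 * (X r u) * (Y r u) * a^2 * P u - 2 * (X r u) * (Y r u) * Q r
      - (X r u) * a * P1 u / 2 + (Y r u) * Q1 r / 2)
      = (2 * r * a * u * a^2 * P u - 2 * r * a * u * Q r - r * \<sigma> * a * P1 u / 2
      + a * u * \<sigma> * Q1 r / 2) / \<sigma>^3"
    unfolding \<sigma>(2) unfolding \<sigma>(3,4) using \<sigma>(1)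
    by (simp add: divide_simps) (simp add: ring_nf power_numeral_reduce)
  also have "2 * r * a * u * a^2 * P u - 2 * r * a * u * Q r - r * \<sigma> * a * P1 u / 2
      + a * u * \<sigma> * Q1 r / 2 = m * (3 * r^2 * a * u - a^3 * u^3) - 2 * q^2 * r * a * u"
    unfolding poly by (simp add: ring_nf power_numeral_reduce)
  also have "(m * (3 * r^2 * a * u - a^3 * u^3) - 2 * q^2 * r * a * u) / \<sigma>^3 = fr.V r u"
    unfolding WV using \<sigma> by (simp add: divide_simps)
  finally show "fr.F4 r u = Q r * P u * (fr.s r u)^2 * fr.V r u"
    unfolding fr.F4_def by (simp add: power3_eq_cube power2_eq_square mult.assoc)
qed

section \<open>The chart, the coframe and its derivatives\<close>

definition chart :: "(real ^ 4) set" where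
  "chart = {x. Sg (x $ 2) (cos (x $ 3)) \<noteq> 0 \<and> Q (x $ 2) \<noteq> 0 \<and> Delta_theta a \<Lambda> (x $ 3) > 0 \<and> sin (x $ 3) \<noteq> 0}"

definition invQ where "invQ r = 1 / Q r"
definition dinvQ where "dinvQ r = - (Q1 r / (Q r)^2)"
definition sinP where "sinP \<theta> = sin \<theta> / P (cos \<theta>)"
definition dsinP where "dsinP \<theta> = cos \<theta> / P (cos \<theta>) + (sin \<theta>)^2 * P1 (cos \<theta>) / (P (cos \<theta>))^2"

abbreviation \<Xi> where "\<Xi> \<equiv> Xi a \<Lambda>"

definition coframe_at :: "4 \<Rightarrow> 4 \<Rightarrow> real \<Rightarrow> real \<Rightarrow> real" where
  "coframe_at b i r \<theta> = pick b
     (pick i (1 / \<Xi>) 0 0 (- (a / \<Xi> * (sin \<theta>)^2)))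
     (pick i 0 (Sg r (cos \<theta>) * invQ r) 0 0)
     (pick i 0 0 (- (Sg r (cos \<theta>) * sinP \<theta>)) 0)
     (pick i (a / \<Xi>) 0 0 (- ((r^2 + a^2) / \<Xi>)))"

definition coframe_r :: "4 \<Rightarrow> 4 \<Rightarrow> real \<Rightarrow> real \<Rightarrow> real" where
  "coframe_r b i r \<theta> = pick b 0
     (pick i 0 (2 * r * invQ r + Sg r (cos \<theta>) * dinvQ r) 0 0)
     (pick i 0 0 (- (2 * r * sinP \<theta>)) 0)
     (pick i 0 0 0 (- (2 * r / \<Xi>)))"

definition coframe_\<theta> :: "4 \<Rightarrow> 4 \<Rightarrow> real \<Rightarrow> real \<Rightarrow> real" where
  "coframe_\<theta> b i r \<theta> = pick b
     (pick i 0 0 0 (- (2 * a / \<Xi> * sin \<theta> * cos \<theta>)))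
     (pick i 0 (- (2 * a^2 * cos \<theta> * sin \<theta> * invQ r)) 0 0)
     (pick i 0 0 (2 * a^2 * cos \<theta> * sin \<theta> * sinP \<theta> - Sg r (cos \<theta>) * dsinP \<theta>) 0)
     0"

text \<open>Reached by differentiating both \<open>coframe_r\<close> and
  \<open>coframe_\<theta>\<close>; this coincidence is the symmetry of second partial derivatives
  demanded of a moving frame.\<close>

definition coframe_r\<theta> :: "4 \<Rightarrow> 4 \<Rightarrow> real \<Rightarrow> real \<Rightarrow> real" where
  "coframe_r\<theta> b i r \<theta> = pick b 0
     (pick i 0 (- (2 * a^2 * cos \<theta> * sin \<theta> * dinvQ r)) 0 0)
     (pick i 0 0 (- (2 * r * dsinP \<theta>)) 0) 0"

definition frame_at :: "4 \<Rightarrow> 4 \<Rightarrow> real \<Rightarrow> real \<Rightarrow> real" where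
  "frame_at b i r \<theta> = pick b
     (pick i (\<Xi> * (r^2 + a^2) / Sg r (cos \<theta>)) 0 0 (\<Xi> * a / Sg r (cos \<theta>)))
     (pick i 0 (Q r / Sg r (cos \<theta>)) 0 0)
     (pick i 0 0 (- (P (cos \<theta>) / (Sg r (cos \<theta>) * sin \<theta>))) 0)
     (pick i (- (\<Xi> * a * (sin \<theta>)^2 / Sg r (cos \<theta>))) 0 0 (- (\<Xi> / Sg r (cos \<theta>))))"

lemma P_cos: "P (cos \<theta>) = (sin \<theta>)^2 * Delta_theta a \<Lambda> \<theta>"
  by (simp add: P_def Delta_theta_def sin_squared_eq)

lemma chartD:
  assumes "x \<in> chart"
  shows "Sg (x $ 2) (cos (x $ 3)) \<noteq> 0" "Q (x $ 2) \<noteq> 0" "P (cos (x $ 3)) \<noteq> 0" "sin (x $ 3) \<noteq> 0"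
  using assms by (auto simp: chart_def P_cos)

lemma open_chart: "open chart"
  unfolding chart_def Sg_def Q_def Delta_theta_def
  by (intro open_Collect_conj open_Collect_neq open_Collect_less continuous_intros)

lemma DERIV_invQ: "Q r \<noteq> 0 \<Longrightarrow> (invQ has_real_derivative dinvQ r) (at r)"
  unfolding invQ_def[abs_def] dinvQ_def
  by (rule DERIV_cong[OF DERIV_divide[OF DERIV_const DERIV_Q]]) (simp_all add: power2_eq_square)

lemma DERIV_sinP: "P (cos \<theta>) \<noteq> 0 \<Longrightarrow> (sinP has_real_derivative dsinP \<theta>) (at \<theta>)"
  unfolding sinP_def[abs_def] dsinP_def
  by (rule DERIV_cong[OF DERIV_divide[OF DERIV_sin DERIV_chain2[OF DERIV_P DERIV_cos]]])
    (simp_all add: divide_simps power2_eq_square)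

lemma DERIV_Sg_\<theta>: "((\<lambda>\<theta>. Sg r (cos \<theta>)) has_real_derivative - (2 * a^2 * cos \<theta> * sin \<theta>)) (at \<theta>)"
  using DERIV_chain2[OF DERIV_Sg_u DERIV_cos] by simp

lemma DERIV_coframe_r: "Q r \<noteq> 0 \<Longrightarrow> ((\<lambda>r. coframe_at b i r \<theta>) has_real_derivative coframe_r b i r \<theta>) (at r)"
  unfolding coframe_at_def coframe_r_def
  by (intro DERIV_pick DERIV_const; (rule DERIV_cong, (rule DERIV_invQ DERIV_Sg_r DERIV_cdivide derivative_intros | assumption)+, simp add: algebra_simps))

lemma DERIV_coframe_\<theta>: "P (cos \<theta>) \<noteq> 0 \<Longrightarrow> ((\<lambda>\<theta>. coframe_at b i r \<theta>) has_real_derivative coframe_\<theta> b i r \<theta>) (at \<theta>)"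
  unfolding coframe_at_def coframe_\<theta>_def
  by (intro DERIV_pick DERIV_const; (rule DERIV_cong, (rule DERIV_sinP DERIV_Sg_\<theta> DERIV_cdivide derivative_intros | assumption)+, simp add: algebra_simps))

lemma DERIV_coframe_r\<theta>: "P (cos \<theta>) \<noteq> 0 \<Longrightarrow> ((\<lambda>\<theta>. coframe_r b i r \<theta>) has_real_derivative coframe_r\<theta> b i r \<theta>) (at \<theta>)"
  unfolding coframe_r_def coframe_r\<theta>_def
  by (intro DERIV_pick DERIV_const; (rule DERIV_cong, (rule DERIV_sinP DERIV_Sg_\<theta> DERIV_cdivide derivative_intros | assumption)+, simp add: algebra_simps))

lemma DERIV_coframe_\<theta>r: "Q r \<noteq> 0 \<Longrightarrow> ((\<lambda>r. coframe_\<theta> b i r \<theta>) has_real_derivative coframe_r\<theta> b i r \<theta>) (at r)"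
  unfolding coframe_\<theta>_def coframe_r\<theta>_def
  by (intro DERIV_pick DERIV_const; (rule DERIV_cong, (rule DERIV_invQ DERIV_Sg_r DERIV_cdivide derivative_intros | assumption)+, simp add: algebra_simps))

definition coframe :: "4 \<Rightarrow> 4 \<Rightarrow> real ^ 4 \<Rightarrow> real" where
  "coframe b i x = coframe_at b i (x $ 2) (x $ 3)"

definition frame :: "4 \<Rightarrow> 4 \<Rightarrow> real ^ 4 \<Rightarrow> real" where
  "frame b i x = frame_at b i (x $ 2) (x $ 3)"

definition sq_length :: "4 \<Rightarrow> real ^ 4 \<Rightarrow> real" where
  "sq_length b x = fr.H (x $ 2) (cos (x $ 3)) b"

definition connection :: "4 \<Rightarrow> 4 \<Rightarrow> 4 \<Rightarrow> real ^ 4 \<Rightarrow> real" where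
  "connection b c d x = fr.C (x $ 2) (cos (x $ 3)) b c d"

lemma partial_coframe:
  assumes "x \<in> chart"
  shows "has_partial k (coframe b i) (pick k 0 (coframe_r b i (x $ 2) (x $ 3)) (coframe_\<theta> b i (x $ 2) (x $ 3)) 0) x"
  unfolding coframe_def[abs_def]
  by (intro has_partial_chart DERIV_coframe_r DERIV_coframe_\<theta> chartD assms)

lemma pdiff_invQ: "x \<in> chart \<Longrightarrow> pdiff k (\<lambda>y. invQ (y $ 2)) x"
  by (intro pdiff_chain[OF DERIV_invQ] pdiff_component chartD)

lemma pdiff_sinP: "x \<in> chart \<Longrightarrow> pdiff k (\<lambda>y. sinP (y $ 3)) x"
  by (intro pdiff_chain[OF DERIV_sinP] pdiff_component chartD)

lemma pdiff_dinvQ: "x \<in> chart \<Longrightarrow> pdiff k (\<lambda>y. dinvQ (y $ 2)) x"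
  unfolding dinvQ_def by (intro pdiff_rules pdiff_chain[OF DERIV_Q] pdiff_chain[OF DERIV_Q1])
    (simp_all add: chartD)

lemma pdiff_dsinP: "x \<in> chart \<Longrightarrow> pdiff k (\<lambda>y. dsinP (y $ 3)) x"
  unfolding dsinP_def by (intro pdiff_rules pdiff_chain[OF DERIV_P] pdiff_chain[OF DERIV_P1])
    (simp_all add: chartD)

lemma pdiff_Sg: "pdiff k (\<lambda>y. Sg (y $ 2) (cos (y $ 3))) x"
  unfolding Sg_def by (intro pdiff_rules)

lemma pdiff_coframe_r: "x \<in> chart \<Longrightarrow> pdiff k (\<lambda>y. coframe_r b i (y $ 2) (y $ 3)) x"
  unfolding coframe_r_def
  by (intro pdiff_pick pdiff_rules pdiff_invQ pdiff_sinP pdiff_dinvQ pdiff_Sg) (simp_all add: Xi_nonzero)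

lemma pdiff_coframe_\<theta>: "x \<in> chart \<Longrightarrow> pdiff k (\<lambda>y. coframe_\<theta> b i (y $ 2) (y $ 3)) x"
  unfolding coframe_\<theta>_def
  by (intro pdiff_pick pdiff_rules pdiff_invQ pdiff_sinP pdiff_dsinP pdiff_Sg) (simp_all add: Xi_nonzero)

lemma partial_partial_coframe:
  assumes x: "x \<in> chart"
  shows "partial k (partial l (coframe b i)) x
     = partial k (\<lambda>y. pick l 0 (coframe_r b i (y $ 2) (y $ 3)) (coframe_\<theta> b i (y $ 2) (y $ 3)) 0) x"
  by (rule partial_cong[OF open_chart x has_partial_imp[OF partial_coframe]])

lemma partial_coframe_commute:
  assumes x: "x \<in> chart"
  shows "partial k (partial l (coframe b i)) x = partial l (partial k (coframe b i)) x"
proof -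
  \<comment> \<open>The pure second derivatives. They enter only for k = l, so their existence is
    enough.\<close>
  obtain D D' where D: "((\<lambda>r. coframe_r b i r (x $ 3)) has_real_derivative D) (at (x $ 2))"
    and D': "((\<lambda>\<theta>. coframe_\<theta> b i (x $ 2) \<theta>) has_real_derivative D') (at (x $ 3))"
  proof -
    obtain D where "has_partial 2 (\<lambda>y. coframe_r b i (y $ 2) (y $ 3)) D x"
      using pdiff_coframe_r[OF x] unfolding pdiff_def by blast
    then have "((\<lambda>h. coframe_r b i (h + x $ 2) (x $ 3)) has_real_derivative D) (at 0)"
      by (simp add: has_partial_def axis_def add.commute)
    moreover obtain D' where "has_partial 3 (\<lambda>y. coframe_\<theta> b i (y $ 2) (y $ 3)) D' x"
      using pdiff_coframe_\<theta>[OF x] unfolding pdiff_def by blast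
    then have "((\<lambda>h. coframe_\<theta> b i (x $ 2) (h + x $ 3)) has_real_derivative D') (at 0)"
      by (simp add: has_partial_def axis_def add.commute)
    ultimately show ?thesis
      using that DERIV_shift[of "\<lambda>r. coframe_r b i r (x $ 3)" D 0 "x $ 2"]
        DERIV_shift[of "\<lambda>\<theta>. coframe_\<theta> b i (x $ 2) \<theta>" D' 0 "x $ 3"] by simp
  qed
  have "partial k (partial l (coframe b i)) x = pick k 0
      (pick l 0 D (coframe_r\<theta> b i (x $ 2) (x $ 3)) 0) (pick l 0 (coframe_r\<theta> b i (x $ 2) (x $ 3)) D' 0) 0" for k l
    unfolding partial_partial_coframe[OF x]
    by (intro has_partial_imp has_partial_chart[of "\<lambda>r \<theta>. pick l 0 (coframe_r b i r \<theta>) (coframe_\<theta> b i r \<theta>) 0"]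
        DERIV_pick DERIV_const D D' DERIV_coframe_r\<theta> DERIV_coframe_\<theta>r chartD x)
  then show ?thesis
    by (simp add: pick_def)
qed

text \<open>The chain rule for u = cos \<theta> contributes - sin \<theta>, and the third frame
  vector is scaled to absorb it. This justifies the derivations built into \<open>dC\<close> and
  \<open>nabR\<close>.\<close>

lemma frame_chart:
  assumes x: "x \<in> chart"
    and "((\<lambda>r. F r (cos (x $ 3))) has_real_derivative Fr) (at (x $ 2))"
    and "((\<lambda>u. F (x $ 2) u) has_real_derivative Fu) (at (cos (x $ 3)))"
  shows "(\<Sum>k\<in>UNIV. frame b k x * partial k (\<lambda>y. F (y $ 2) (cos (y $ 3))) x)
    = pick b 0 (Q (x $ 2) * fr.s (x $ 2) (cos (x $ 3)) * Fr) (P (cos (x $ 3)) * fr.s (x $ 2) (cos (x $ 3)) * Fu) 0"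
  unfolding has_partial_imp[OF has_partial_chart_cos[OF assms(2,3)]] s_eq[OF chartD(1)[OF x]]
  using exhaust_4[of b] chartD[OF x] by (elim disjE) (simp_all add: sum_4 frame_def frame_at_def)

lemma dual_frame:
  assumes x: "x \<in> chart"
  shows "(\<Sum>k\<in>UNIV. coframe b k x * frame c k x) = (if b = c then 1 else 0)"
proof -
  define \<sigma> where "\<sigma> = Sg (x $ 2) (cos (x $ 3))"
  \<comment> \<open>Up to the factor - 1 / \<Xi>^2, the determinant of the t-phi block of the
    coframe is r^2 + a^2 - a^2 sin^2 \<theta>; this identity makes it \<sigma>.\<close>
  have \<sigma>: "(x $ 2)^2 + a^2 = \<sigma> + a^2 * (sin (x $ 3))^2"
    by (simp add: \<sigma>_def Sg_def cos_squared_eq algebra_simps)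
  show ?thesis
    using exhaust_4[of b] exhaust_4[of c] chartD[OF x] Xi_nonzero unfolding \<sigma>_def[symmetric]
    by (elim disjE; simp add: sum_4 coframe_def frame_def coframe_at_def frame_at_def invQ_def sinP_def \<sigma>_def[symmetric];
        simp add: divide_simps; use \<sigma> in \<open>simp add: ring_nf\<close>)
qed

lemma metric_coframe:
  assumes x: "x \<in> chart"
  shows "KNdS_metric a m q \<Lambda> x $ i $ j = (\<Sum>b\<in>UNIV. sq_length b x * coframe b i x * coframe b j x)"
proof -
  define \<sigma> where "\<sigma> = Sg (x $ 2) (cos (x $ 3))"
  have defs: "rho_sq a (x $ 2) (x $ 3) = \<sigma>" "Delta_r a m q \<Lambda> (x $ 2) = Q (x $ 2)"
    by (simp_all add: \<sigma>_def Sg_def rho_sq_def Delta_r_def Q_def)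
  have th: "Delta_theta a \<Lambda> (x $ 3) \<noteq> 0"
    using x by (simp add: chart_def)
  have sinP: "sinP (x $ 3) = 1 / (sin (x $ 3) * Delta_theta a \<Lambda> (x $ 3))"
    using chartD[OF x] th by (simp add: sinP_def P_cos power2_eq_square)
  have sq_length: "sq_length b x = pick b (- (Q (x $ 2) / \<sigma>)) (Q (x $ 2) / \<sigma>)
    ((sin (x $ 3))^2 * Delta_theta a \<Lambda> (x $ 3) / \<sigma>) ((sin (x $ 3))^2 * Delta_theta a \<Lambda> (x $ 3) / \<sigma>)" for b
    unfolding sq_length_def fr.H_def s_eq[OF chartD(1)[OF x]] by (simp add: \<sigma>_def P_cos)
  show ?thesis
    using exhaust_4[of i] exhaust_4[of j] chartD[OF x] Xi_nonzero th unfolding \<sigma>_def[symmetric]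
    by (elim disjE; simp add: KNdS_metric_def Let_def defs sum_4 sq_length coframe_def coframe_at_def invQ_def sinP \<sigma>_def[symmetric] axis_def;
        simp add: divide_simps; simp add: ring_nf)
qed

lemma metricity_connection:
  assumes x: "x \<in> chart"
  shows "(if b = c then \<Sum>k\<in>UNIV. frame d k x * partial k (sq_length b) x else 0) = sq_length c x * connection c d b x + sq_length b x * connection b d c x"
proof -
  let ?r = "x $ 2" and ?u = "cos (x $ 3)"
  note Sg = chartD(1)[OF x]
  have hr: "((\<lambda>r. fr.H r ?u b) has_real_derivative pick b
     (- (Q1 ?r * fr.s ?r ?u - 2 * X ?r ?u * fr.s ?r ?u * Q ?r)) (Q1 ?r * fr.s ?r ?u - 2 * X ?r ?u * fr.s ?r ?u * Q ?r)
     (- 2 * X ?r ?u * fr.s ?r ?u * P ?u) (- 2 * X ?r ?u * fr.s ?r ?u * P ?u)) (at ?r)"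
    unfolding fr.H_def
    by (intro DERIV_pick; (rule DERIV_cong, (rule D_r derivative_intros Sg)+, simp add: algebra_simps))
  have hu: "((\<lambda>u. fr.H ?r u b) has_real_derivative pick b
     (2 * a * Y ?r ?u * fr.s ?r ?u * Q ?r) (- 2 * a * Y ?r ?u * fr.s ?r ?u * Q ?r)
     (P1 ?u * fr.s ?r ?u - 2 * a * Y ?r ?u * fr.s ?r ?u * P ?u) (P1 ?u * fr.s ?r ?u - 2 * a * Y ?r ?u * fr.s ?r ?u * P ?u)) (at ?u)"
    unfolding fr.H_def
    by (intro DERIV_pick; (rule DERIV_cong, (rule D_u derivative_intros Sg)+, simp add: algebra_simps))
  show ?thesis
    using exhaust_4[of b] exhaust_4[of c] exhaust_4[of d]
    unfolding frame_chart[OF x hr hu, folded sq_length_def] connection_def sq_length_def fr.H_def fr.C_def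
    by (elim disjE) (simp_all add: conn_def algebra_simps)
qed

lemma torsion_connection:
  assumes x: "x \<in> chart"
  shows "partial k (coframe b l) x - partial l (coframe b k) x
    = (\<Sum>c\<in>UNIV. \<Sum>d\<in>UNIV. connection b c d x * (coframe c l x * coframe d k x - coframe c k x * coframe d l x))"
proof -
  let ?f = "\<lambda>k l. partial k (coframe b l) x - partial l (coframe b k) x"
  let ?g = "\<lambda>k l. \<Sum>c\<in>UNIV. \<Sum>d\<in>UNIV. connection b c d x * (coframe c l x * coframe d k x - coframe c k x * coframe d l x)"
  define r \<theta> \<sigma> where "r = x $ 2" and "\<theta> = x $ 3" and "\<sigma> = Sg r (cos \<theta>)"
  have nz: "\<sigma> \<noteq> 0" "Q r \<noteq> 0" "P (cos \<theta>) \<noteq> 0" "sin \<theta> \<noteq> 0"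
    using chartD[OF x] by (simp_all add: r_def \<theta>_def \<sigma>_def)
  note p = has_partial_imp[OF partial_coframe[OF x], folded r_def \<theta>_def]
  have C: "connection c i j x = conn a (1 / \<sigma> * (Q1 r / 2 - r / \<sigma> * Q r)) (1 / \<sigma> * (P1 (cos \<theta>) / 2 - a * (a * cos \<theta> / \<sigma>) * P (cos \<theta>)))
     (r / \<sigma> * P (cos \<theta>) * (1 / \<sigma>)) (a * cos \<theta> / \<sigma> * P (cos \<theta>) * (1 / \<sigma>))
     (r / \<sigma> * Q r * (1 / \<sigma>)) (a * cos \<theta> / \<sigma> * Q r * (1 / \<sigma>)) c i j" for c i j
    unfolding connection_def fr.C_def unfolding s_eq[OF chartD(1)[OF x]] unfolding X_def Y_def by (simp add: r_def \<theta>_def \<sigma>_def)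
  \<comment> \<open>Even powers of the sine are traded for cosines so that normal forms are unique.
    The second form catches products that are associated to the right.\<close>
  have sin2: "sin \<theta> * sin \<theta> = 1 - cos \<theta> * cos \<theta>" "sin \<theta> * (sin \<theta> * z) = (1 - cos \<theta> * cos \<theta>) * z" for z
    using sin_squared_eq[of \<theta>] by (simp_all add: power2_eq_square flip: mult.assoc)
  note defs = p C coframe_def r_def[symmetric] \<theta>_def[symmetric] coframe_at_def coframe_r_def coframe_\<theta>_def sum_4 conn_def
    \<sigma>_def[symmetric] invQ_def dinvQ_def sinP_def dsinP_def
  have 1: "?f 1 2 = ?g 1 2" "?f 1 3 = ?g 1 3" "?f 1 4 = ?g 1 4"
    using exhaust_4[of b] nz Xi_nonzero
    by (elim disjE; simp add: defs; simp add: divide_simps; simp add: \<sigma>_def Sg_def sin2 ring_nf)+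
  have 2: "?f 2 3 = ?g 2 3" "?f 2 4 = ?g 2 4" "?f 3 4 = ?g 3 4"
    using exhaust_4[of b] nz Xi_nonzero
    by (elim disjE; simp add: defs; simp add: divide_simps; simp add: \<sigma>_def Sg_def sin2 ring_nf)+
  show ?thesis
    by (rule antisym_4_eqI[of ?f ?g]) (simp_all only: 1 2, simp_all add: sum_negf[symmetric] algebra_simps)
qed

lemma pdiff_frame: "x \<in> chart \<Longrightarrow> pdiff k (frame b i) x"
  unfolding frame_def[abs_def] frame_at_def
  by (intro pdiff_pick pdiff_rules pdiff_Sg pdiff_chain[OF DERIV_Q] pdiff_chain[OF DERIV_P])
    (simp_all add: chartD)

lemma chart_cos_pdiff:
  fixes x :: "real ^ 4"
  assumes "((\<lambda>r. F r (cos (x $ 3))) has_real_derivative Fr) (at (x $ 2))"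
    and "((\<lambda>u. F (x $ 2) u) has_real_derivative Fu) (at (cos (x $ 3)))"
  shows "pdiff k (\<lambda>y. F (y $ 2) (cos (y $ 3))) x"
  by (rule has_partial_pdiff[OF has_partial_chart_cos[OF assms]])

lemma pdiff_sq_length: "x \<in> chart \<Longrightarrow> pdiff k (sq_length b) x"
  unfolding sq_length_def[abs_def] fr.H_def
  by (intro pdiff_pick pdiff_rules chart_cos_pdiff[OF DERIV_s_r DERIV_s_u] pdiff_chain[OF DERIV_Q]
      pdiff_chain[OF DERIV_P] chartD)

lemma pdiff_connection: "x \<in> chart \<Longrightarrow> pdiff k (connection b c d) x"
  unfolding connection_def[abs_def] by (intro chart_cos_pdiff[OF DERIV_C_r DERIV_C_u] chartD)

sublocale mf: moving_frame "KNdS_metric a m q \<Lambda>" chart coframe frame sq_length connection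
proof
  show "sq_length b x \<noteq> 0" if "x \<in> chart" for b x
    using chartD[OF that] exhaust_4[of b] s_eq[OF chartD(1)[OF that]]
    unfolding sq_length_def fr.H_def by (elim disjE) simp_all
  show "pdiff k (partial l (coframe b i)) x" if "x \<in> chart" for x k l b i
  proof -
    have "pdiff k (partial l (coframe b i)) x
      \<longleftrightarrow> pdiff k (\<lambda>y. pick l 0 (coframe_r b i (y $ 2) (y $ 3)) (coframe_\<theta> b i (y $ 2) (y $ 3)) 0) x"
      by (rule pdiff_cong[OF open_chart that has_partial_imp[OF partial_coframe]])
    then show ?thesis
      by (simp add: pdiff_pick pdiff_const pdiff_coframe_r pdiff_coframe_\<theta> that)
  qed
qed (rule open_chart metric_coframe dual_frame has_partial_pdiff[OF partial_coframe] partial_coframe_commute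
    pdiff_frame pdiff_sq_length pdiff_connection metricity_connection torsion_connection | assumption)+

section \<open>From the frame algebra to the invariant\<close>

lemma frame_deriv_connection:
  "x \<in> chart \<Longrightarrow> mf.frame_deriv f (connection b c d) x = fr.dC (x $ 2) (cos (x $ 3)) f b c d"
  unfolding mf.frame_deriv_def connection_def[abs_def] fr.dC_def
  by (rule frame_chart[OF _ DERIV_C_r DERIV_C_u]) (simp_all add: chartD)

lemma frame_riemann_eq:
  assumes x: "x \<in> chart"
  shows "mf.frame_riemann b c d f x = fr.Rm (x $ 2) (cos (x $ 3)) b c d f"
proof -
  have "mf.frame_riemann b c d f x = fr.curvC (x $ 2) (cos (x $ 3)) b c d f"
    by (simp add: mf.frame_riemann_def fr.curvC_def frame_deriv_connection[OF x] connection_def sq_length_def)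
  then show ?thesis
    unfolding fr.curvC_eq field_equations[OF chartD(1)[OF x]] fr.Rm_def .
qed

lemma pdiff_frame_riemann:
  assumes x: "x \<in> chart"
  shows "pdiff k (mf.frame_riemann b c d f) x"
proof -
  have "pdiff k (mf.frame_riemann b c d f) x \<longleftrightarrow> pdiff k (\<lambda>y. fr.Rm (y $ 2) (cos (y $ 3)) b c d f) x"
    by (rule pdiff_cong[OF open_chart x frame_riemann_eq])
  moreover have "pdiff k (\<lambda>y. fr.Rm (y $ 2) (cos (y $ 3)) b c d f) x"
    by (intro chart_cos_pdiff[OF DERIV_R_r DERIV_R_u] chartD x)
  ultimately show ?thesis
    by simp
qed

lemma frame_nabla_eq:
  assumes x: "x \<in> chart"
  shows "mf.frame_nabla4 mf.frame_riemann i b c d f x = fr.nabR (x $ 2) (cos (x $ 3)) i b c d f"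
proof -
  have "mf.frame_deriv i (mf.frame_riemann b c d f) x
    = mf.frame_deriv i (\<lambda>y. fr.Rm (y $ 2) (cos (y $ 3)) b c d f) x"
    unfolding mf.frame_deriv_def
    by (intro sum.cong refl arg_cong2[where f = "(*)"] partial_cong[OF open_chart x frame_riemann_eq])
  also have "\<dots> = pick i 0 (Q (x $ 2) * fr.s (x $ 2) (cos (x $ 3)) * fr.Rr (x $ 2) (cos (x $ 3)) b c d f)
      (P (cos (x $ 3)) * fr.s (x $ 2) (cos (x $ 3)) * fr.Ru (x $ 2) (cos (x $ 3)) b c d f) 0"
    unfolding mf.frame_deriv_def
    by (rule frame_chart[OF x DERIV_R_r DERIV_R_u]) (simp_all add: chartD x)
  finally show ?thesis
    by (simp add: mf.frame_nabla4_def fr.nabR_def frame_riemann_eq[OF x] connection_def)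
qed

lemma karlhede_eq:
  assumes x: "x \<in> chart" and r: "r = x $ 2" and u: "u = cos (x $ 3)"
  shows "karlhede (KNdS_metric a m q \<Lambda>) x = fr.s r u *
    (Q r * (4 * (fr.A3 r u)^2 + 32 * (fr.A1 r u)^2 + 32 * (fr.A2 r u)^2 - 64 * (fr.B1 r u)^2 - 16 * (fr.B2 r u)^2)
     + a^2 * P u * (32 * (fr.B1 r u)^2 - 16 * (fr.A1 r u)^2 - 64 * (fr.A2 r u)^2 + 32 * (fr.B2 r u)^2 + 4 * (fr.B3 r u)^2))"
proof -
  have nz: "Q r \<noteq> 0" "P u \<noteq> 0" "fr.s r u \<noteq> 0"
    using chartD[OF x] by (simp_all add: r u s_eq)
  have "karlhede (KNdS_metric a m q \<Lambda>) x = (\<Sum>f\<in>UNIV. fr.norm_nabR r u f)"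
    unfolding mf.karlhede_frame[OF x pdiff_frame_riemann[OF x]] frame_nabla_eq[OF x] fr.norm_nabR_def sq_length_def r u ..
  also have "\<dots> = fr.norm_nabR r u 1 + fr.norm_nabR r u 2 + fr.norm_nabR r u 3 + fr.norm_nabR r u 4"
    by (rule sum_4)
  finally show ?thesis
    unfolding fr.norm_nabR_1[OF nz] fr.norm_nabR_2[OF nz] fr.norm_nabR_3[OF nz] fr.norm_nabR_4[OF nz]
    by (simp add: algebra_simps)
qed

text \<open>Quartic terms in X, Y and terms s times a cubic have the same denominator, the fourth
  power of \<open>Sg\<close>. So all six polynomials reduce to numerators over one common
  power.\<close>

lemma A1_eq: "Sg r u \<noteq> 0 \<Longrightarrow> fr.A1 r u = (3 * m * (r^4 - 6 * a^2 * r^2 * u^2 + a^4 * u^4) - 4 * q^2 * r * (r^2 - 2 * a^2 * u^2)) / (Sg r u)^4"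
  unfolding fr.A1_def s_eq unfolding X_def Y_def
  by (simp add: divide_simps) (simp add: ring_nf power_numeral_reduce)

lemma A2_eq: "Sg r u \<noteq> 0 \<Longrightarrow> fr.A2 r u = (3 * m * (r^4 - 6 * a^2 * r^2 * u^2 + a^4 * u^4) - 2 * q^2 * r * (r^2 - 5 * a^2 * u^2)) / (Sg r u)^4"
  unfolding fr.A2_def s_eq unfolding X_def Y_def
  by (simp add: divide_simps) (simp add: ring_nf power_numeral_reduce)

lemma A3_eq: "Sg r u \<noteq> 0 \<Longrightarrow> fr.A3 r u = (6 * m * (r^4 - 6 * a^2 * r^2 * u^2 + a^4 * u^4) - 12 * q^2 * r * (r^2 - a^2 * u^2)) / (Sg r u)^4"
  unfolding fr.A3_def s_eq unfolding X_def Y_def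
  by (simp add: divide_simps) (simp add: ring_nf power_numeral_reduce)

lemma B1_eq: "Sg r u \<noteq> 0 \<Longrightarrow> fr.B1 r u = (12 * m * r * a * u * (r^2 - a^2 * u^2) - 2 * q^2 * a * u * (5 * r^2 - a^2 * u^2)) / (Sg r u)^4"
  unfolding fr.B1_def s_eq unfolding X_def Y_def
  by (simp add: divide_simps) (simp add: ring_nf power_numeral_reduce)

lemma B2_eq: "Sg r u \<noteq> 0 \<Longrightarrow> fr.B2 r u = (12 * m * r * a * u * (r^2 - a^2 * u^2) - 4 * q^2 * a * u * (2 * r^2 - a^2 * u^2)) / (Sg r u)^4"
  unfolding fr.B2_def s_eq unfolding X_def Y_def
  by (simp add: divide_simps) (simp add: ring_nf power_numeral_reduce)

lemma B3_eq: "Sg r u \<noteq> 0 \<Longrightarrow> fr.B3 r u = (24 * m * r * a * u * (r^2 - a^2 * u^2) - 12 * q^2 * a * u * (r^2 - a^2 * u^2)) / (Sg r u)^4"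
  unfolding fr.B3_def s_eq unfolding X_def Y_def
  by (simp add: divide_simps) (simp add: ring_nf power_numeral_reduce)

end

theorem theorem1:
  fixes a m q \<Lambda> r \<theta> c :: real and x :: "real ^ 4"
  assumes "r = x $ 2" and "\<theta> = x $ 3" and "c = cos \<theta>"
    and "rho_sq a r \<theta> \<noteq> 0"
    and "Delta_r a m q \<Lambda> r \<noteq> 0"
    and "Delta_theta a \<Lambda> \<theta> > 0"
    and "Xi a \<Lambda> \<noteq> 0"
    and "sin \<theta> \<noteq> 0"
  shows "karlhede (KNdS_metric a m q \<Lambda>) x =
    1 / (3 * (r^2 + a^2 * c^2)^9) *
    (720 * \<Lambda> * a^12 * m^2 * c^12
     - 720 * a^10 * (\<Lambda> * a^2 * m^2 + 28 * \<Lambda> * m^2 * r^2 - 16 * \<Lambda> * m * q^2 * r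
         + 76/45 * \<Lambda> * q^4 - 3 * m^2) * c^10
     + 19440 * a^8 * (23/9 * \<Lambda> * m^2 * r^4 - 8/3 * \<Lambda> * m * q^2 * r^3
         + (\<Lambda> * a^2 * m^2 + 248/405 * \<Lambda> * q^4 - 3 * m^2) * r^2
         - 16/27 * m * (a^2 * q^2 * \<Lambda> + 3/8 * m^2 - 3 * q^2) * r
         + 76/1215 * q^2 * (a^2 * q^2 * \<Lambda> + 135/76 * m^2 - 3 * q^2)) * c^8
     - 30240 * a^6 * (- (22/35) * \<Lambda> * m * q^2 * r^5
         + (\<Lambda> * a^2 * m^2 + 278/945 * \<Lambda> * q^4 - 3 * m^2) * r^4
         - 10/7 * m * (a^2 * q^2 * \<Lambda> + 14/5 * m^2 - 3 * q^2) * r^3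
         + 356/945 * q^2 * (a^2 * q^2 * \<Lambda> + 1755/178 * m^2 - 3 * q^2) * r^2
         + 2/7 * q^2 * (a^2 - 151/45 * q^2) * m * r
         - 22/315 * a^2 * q^4 + 16/315 * q^6) * c^6
     - 30240 * a^4 * r^2 * (23/14 * \<Lambda> * m^2 * r^6 - 166/105 * \<Lambda> * m * q^2 * r^5
         + (\<Lambda> * a^2 * m^2 + 278/945 * \<Lambda> * q^4 - 3 * m^2) * r^4
         - 74/105 * (a^2 * q^2 * \<Lambda> - 525/37 * m^2 - 3 * q^2) * m * r^3
         - 103/7 * m^2 * q^2 * r^2
         - 2/7 * q^2 * (a^2 - 353/15 * q^2) * m * r
         + 26/105 * a^2 * q^4 - 14/15 * q^6) * c^4
     + 19440 * a^2 * r^4 * (28/27 * \<Lambda> * m^2 * r^6 - 76/45 * \<Lambda> * m * q^2 * r^5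
         + (\<Lambda> * a^2 * m^2 + 248/405 * \<Lambda> * q^4 - 3 * m^2) * r^4
         - 44/27 * (a^2 * q^2 * \<Lambda> - 42/11 * m^2 - 3 * q^2) * m * r^3
         + 712/1215 * q^2 * (a^2 * q^2 * \<Lambda> - 4023/178 * m^2 - 3 * q^2) * r^2
         + 4/5 * q^2 * (a^2 + 295/27 * q^2) * m * r
         - 52/135 * a^2 * q^4 - 248/135 * q^6) * c^2
     - 720 * r^6 * (\<Lambda> * m^2 * r^6 - 12/5 * \<Lambda> * m * q^2 * r^5
         + (\<Lambda> * a^2 * m^2 + 76/45 * \<Lambda> * q^4 - 3 * m^2) * r^4
         - 12/5 * (a^2 * q^2 * \<Lambda> - 5/2 * m^2 - 3 * q^2) * m * r^3
         + 76/45 * q^2 * (a^2 * q^2 * \<Lambda> - 783/76 * m^2 - 3 * q^2) * r^2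
         + 12/5 * q^2 * (a^2 + 65/9 * q^2) * m * r
         - 44/15 * a^2 * q^4 - 76/15 * q^6))"
proof -
  interpret knds a m q \<Lambda>
    by standard (rule assms(7))
  have x: "x \<in> chart"
    using assms by (simp add: chart_def Sg_def Q_def rho_sq_def Delta_r_def)
  have \<sigma>: "Sg r c \<noteq> 0"
    using assms(3,4) by (simp add: Sg_def rho_sq_def)
  \<comment> \<open>Letters in place of the numerators allow the denominators to be cleared before
    the long polynomials appear. The leading s gives one factor 1 / \<sigma> and each square eight,
    hence the ninth power.\<close>
  have clear: "1 / \<sigma> * (Q' * (4 * (u3 / \<sigma>^4)^2 + 32 * (u1 / \<sigma>^4)^2 + 32 * (u2 / \<sigma>^4)^2
        - 64 * (v1 / \<sigma>^4)^2 - 16 * (v2 / \<sigma>^4)^2)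
      + a^2 * P' * (32 * (v1 / \<sigma>^4)^2 - 16 * (u1 / \<sigma>^4)^2 - 64 * (u2 / \<sigma>^4)^2
        + 32 * (v2 / \<sigma>^4)^2 + 4 * (v3 / \<sigma>^4)^2))
    = 1 / (3 * \<sigma>^9) * (3 * (Q' * (4 * u3^2 + 32 * u1^2 + 32 * u2^2 - 64 * v1^2 - 16 * v2^2)
      + a^2 * P' * (32 * v1^2 - 16 * u1^2 - 64 * u2^2 + 32 * v2^2 + 4 * v3^2)))"
    if "\<sigma> \<noteq> 0" for \<sigma> Q' P' u1 u2 u3 v1 v2 v3 :: real
    using that by (simp add: divide_simps power2_eq_square; simp add: algebra_simps power_numeral_reduce)
  \<comment> \<open>A polynomial identity with rational coefficients in a, m, q, \<Lambda>, r, c.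
    The fractions on the right arise because each bracket is scaled to give \<Lambda> a^2 m^2 the
    coefficient 1.\<close>
  have poly: "3 * (((1 - \<Lambda> / 3 * r^2) * (r^2 + a^2) - 2 * m * r + q^2) * (4 * (6 * m * (r^4 - 6 * a^2 * r^2 * c^2 + a^4 * c^4) - 12 * q^2 * r * (r^2 - a^2 * c^2))^2 + 32 * (3 * m * (r^4 - 6 * a^2 * r^2 * c^2 + a^4 * c^4) - 4 * q^2 * r * (r^2 - 2 * a^2 * c^2))^2 + 32 * (3 * m * (r^4 - 6 * a^2 * r^2 * c^2 + a^4 * c^4) - 2 * q^2 * r * (r^2 - 5 * a^2 * c^2))^2
       - 64 * (12 * m * r * a * c * (r^2 - a^2 * c^2) - 2 * q^2 * a * c * (5 * r^2 - a^2 * c^2))^2 - 16 * (12 * m * r * a * c * (r^2 - a^2 * c^2) - 4 * q^2 * a * c * (2 * r^2 - a^2 * c^2))^2)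
     + a^2 * ((1 - c^2) * (1 + a^2 * \<Lambda> / 3 * c^2)) * (32 * (12 * m * r * a * c * (r^2 - a^2 * c^2) - 2 * q^2 * a * c * (5 * r^2 - a^2 * c^2))^2 - 16 * (3 * m * (r^4 - 6 * a^2 * r^2 * c^2 + a^4 * c^4) - 4 * q^2 * r * (r^2 - 2 * a^2 * c^2))^2
       - 64 * (3 * m * (r^4 - 6 * a^2 * r^2 * c^2 + a^4 * c^4) - 2 * q^2 * r * (r^2 - 5 * a^2 * c^2))^2 + 32 * (12 * m * r * a * c * (r^2 - a^2 * c^2) - 4 * q^2 * a * c * (2 * r^2 - a^2 * c^2))^2 + 4 * (24 * m * r * a * c * (r^2 - a^2 * c^2) - 12 * q^2 * a * c * (r^2 - a^2 * c^2))^2)) =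
    (720 * \<Lambda> * a^12 * m^2 * c^12
     - 720 * a^10 * (\<Lambda> * a^2 * m^2 + 28 * \<Lambda> * m^2 * r^2 - 16 * \<Lambda> * m * q^2 * r
         + 76/45 * \<Lambda> * q^4 - 3 * m^2) * c^10
     + 19440 * a^8 * (23/9 * \<Lambda> * m^2 * r^4 - 8/3 * \<Lambda> * m * q^2 * r^3
         + (\<Lambda> * a^2 * m^2 + 248/405 * \<Lambda> * q^4 - 3 * m^2) * r^2
         - 16/27 * m * (a^2 * q^2 * \<Lambda> + 3/8 * m^2 - 3 * q^2) * r
         + 76/1215 * q^2 * (a^2 * q^2 * \<Lambda> + 135/76 * m^2 - 3 * q^2)) * c^8
     - 30240 * a^6 * (- (22/35) * \<Lambda> * m * q^2 * r^5
         + (\<Lambda> * a^2 * m^2 + 278/945 * \<Lambda> * q^4 - 3 * m^2) * r^4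
         - 10/7 * m * (a^2 * q^2 * \<Lambda> + 14/5 * m^2 - 3 * q^2) * r^3
         + 356/945 * q^2 * (a^2 * q^2 * \<Lambda> + 1755/178 * m^2 - 3 * q^2) * r^2
         + 2/7 * q^2 * (a^2 - 151/45 * q^2) * m * r
         - 22/315 * a^2 * q^4 + 16/315 * q^6) * c^6
     - 30240 * a^4 * r^2 * (23/14 * \<Lambda> * m^2 * r^6 - 166/105 * \<Lambda> * m * q^2 * r^5
         + (\<Lambda> * a^2 * m^2 + 278/945 * \<Lambda> * q^4 - 3 * m^2) * r^4
         - 74/105 * (a^2 * q^2 * \<Lambda> - 525/37 * m^2 - 3 * q^2) * m * r^3
         - 103/7 * m^2 * q^2 * r^2
         - 2/7 * q^2 * (a^2 - 353/15 * q^2) * m * r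
         + 26/105 * a^2 * q^4 - 14/15 * q^6) * c^4
     + 19440 * a^2 * r^4 * (28/27 * \<Lambda> * m^2 * r^6 - 76/45 * \<Lambda> * m * q^2 * r^5
         + (\<Lambda> * a^2 * m^2 + 248/405 * \<Lambda> * q^4 - 3 * m^2) * r^4
         - 44/27 * (a^2 * q^2 * \<Lambda> - 42/11 * m^2 - 3 * q^2) * m * r^3
         + 712/1215 * q^2 * (a^2 * q^2 * \<Lambda> - 4023/178 * m^2 - 3 * q^2) * r^2
         + 4/5 * q^2 * (a^2 + 295/27 * q^2) * m * r
         - 52/135 * a^2 * q^4 - 248/135 * q^6) * c^2
     - 720 * r^6 * (\<Lambda> * m^2 * r^6 - 12/5 * \<Lambda> * m * q^2 * r^5
         + (\<Lambda> * a^2 * m^2 + 76/45 * \<Lambda> * q^4 - 3 * m^2) * r^4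
         - 12/5 * (a^2 * q^2 * \<Lambda> - 5/2 * m^2 - 3 * q^2) * m * r^3
         + 76/45 * q^2 * (a^2 * q^2 * \<Lambda> - 783/76 * m^2 - 3 * q^2) * r^2
         + 12/5 * q^2 * (a^2 + 65/9 * q^2) * m * r
         - 44/15 * a^2 * q^4 - 76/15 * q^6))"
    by algebra
  have "karlhede (KNdS_metric a m q \<Lambda>) x = 1 / (3 * (Sg r c)^9) * (3 * (((1 - \<Lambda> / 3 * r^2) * (r^2 + a^2) - 2 * m * r + q^2) * (4 * (6 * m * (r^4 - 6 * a^2 * r^2 * c^2 + a^4 * c^4) - 12 * q^2 * r * (r^2 - a^2 * c^2))^2 + 32 * (3 * m * (r^4 - 6 * a^2 * r^2 * c^2 + a^4 * c^4) - 4 * q^2 * r * (r^2 - 2 * a^2 * c^2))^2 + 32 * (3 * m * (r^4 - 6 * a^2 * r^2 * c^2 + a^4 * c^4) - 2 * q^2 * r * (r^2 - 5 * a^2 * c^2))^2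
       - 64 * (12 * m * r * a * c * (r^2 - a^2 * c^2) - 2 * q^2 * a * c * (5 * r^2 - a^2 * c^2))^2 - 16 * (12 * m * r * a * c * (r^2 - a^2 * c^2) - 4 * q^2 * a * c * (2 * r^2 - a^2 * c^2))^2)
     + a^2 * ((1 - c^2) * (1 + a^2 * \<Lambda> / 3 * c^2)) * (32 * (12 * m * r * a * c * (r^2 - a^2 * c^2) - 2 * q^2 * a * c * (5 * r^2 - a^2 * c^2))^2 - 16 * (3 * m * (r^4 - 6 * a^2 * r^2 * c^2 + a^4 * c^4) - 4 * q^2 * r * (r^2 - 2 * a^2 * c^2))^2
       - 64 * (3 * m * (r^4 - 6 * a^2 * r^2 * c^2 + a^4 * c^4) - 2 * q^2 * r * (r^2 - 5 * a^2 * c^2))^2 + 32 * (12 * m * r * a * c * (r^2 - a^2 * c^2) - 4 * q^2 * a * c * (2 * r^2 - a^2 * c^2))^2 + 4 * (24 * m * r * a * c * (r^2 - a^2 * c^2) - 12 * q^2 * a * c * (r^2 - a^2 * c^2))^2)))"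
    unfolding karlhede_eq[OF x assms(1) assms(3)[unfolded assms(2)]] s_eq[OF \<sigma>]
      A1_eq[OF \<sigma>] A2_eq[OF \<sigma>] A3_eq[OF \<sigma>] B1_eq[OF \<sigma>] B2_eq[OF \<sigma>] B3_eq[OF \<sigma>]
    unfolding clear[OF \<sigma>] Q_def P_def ..
  then show ?thesis
    unfolding poly Sg_def .
qed

end
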